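(* Let $D$ be a self-adjoint operator with compact resolvent on a separable Hilbert space $\mathcal{H}$. Let $\{\lambda_n\}_{n=0}^\infty$ be the eigenvalues of $|D|$, counted with multiplicity, in non-decreasing order, and let $P_\lambda:=\chi_{[-\lambda,\lambda]}(D)$. Assume there exists $\beta\ge0$ such that $\operatorname{Tr}(e^{-t|D|})<\infty$ for $t>\beta$ and $\lim_{t\searrow\beta}\operatorname{Tr}(e^{-t|D|})=\infty$. Then, for any extended limit $\omega\in\ell_\infty^*$ there exists an extended limit $\hat\omega_{D,\beta}\in\ell_\infty^*$, depending on $D$ and $\beta$, such that $$\omega\bigg(\frac{\operatorname{Tr}(ae^{-(\beta+\frac1n)|D|})}{\operatorname{Tr}(e^{-(\beta+\frac1n)|D|})}\bigg)=\hat\omega_{D,\beta}\bigg(\frac{\operatorname{Tr}(P_{\lambda_n}aP_{\lambda_n})}{\operatorname{Tr}(P_{\lambda_n})}\bigg),\qquad a\in B(\mathcal{H}).$$ Furthermore, for every $a\in B(\mathcal{H})$, $$\lim_{\lambda\to\infty}\frac{\operatorname{Tr}(P_\lambda aP_\lambda)}{\operatorname{Tr}(P_\lambda)}=\lim_{t\searrow\beta}\frac{\operatorname{Tr}(ae^{-t|D|})}{\operatorname{Tr}(e^{-t|D|})},$$ in the sense that if the limit on the left-hand side exists, then the limit on the right-hand side exists and the equality holds.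
   Context: An extended limit is a state $\omega$ on $\ell_\infty$ (bounded complex sequences) which vanishes on all sequences converging to $0$; $\omega(a_n)$ denotes $\omega$ applied to the sequence with $n$-th term $a_n$. (Finitely many terms may be undefined, such as $n=0$ in $1/n$; they are assigned arbitrary values, which does not affect $\omega$.) The same $\hat\omega_{D,\beta}$ serves all $a\in B(\mathcal{H})$. *)

theory Defs
  imports "HOL-Analysis.Analysis"
begin

section \<open>Complex Hilbert spaces\<close>

text \<open>The distribution only has real inner product spaces. The real structure inherited from
  \<^class>\<open>real_inner\<close> (and with it the norm and the topology) is the one underlying the complex
  structure. The inner product is linear in the second argument.\<close>

class complex_inner = real_inner +
  fixes scaleC :: "complex \<Rightarrow> 'a \<Rightarrow> 'a"  (infixr \<open>*\<^sub>C\<close> 75)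
    and cinner :: "'a \<Rightarrow> 'a \<Rightarrow> complex"
  assumes scaleC_add_right: "c *\<^sub>C (x + y) = c *\<^sub>C x + c *\<^sub>C y"
    and scaleC_add_left: "(c + d) *\<^sub>C x = c *\<^sub>C x + d *\<^sub>C x"
    and scaleC_scaleC: "c *\<^sub>C (d *\<^sub>C x) = (c * d) *\<^sub>C x"
    and scaleR_scaleC: "r *\<^sub>R x = complex_of_real r *\<^sub>C x"
    and cinner_commute: "cinner x y = cnj (cinner y x)"
    and cinner_add_right: "cinner x (y + z) = cinner x y + cinner x z"
    and cinner_scaleC_right: "cinner x (c *\<^sub>C y) = c * cinner x y"
    and inner_eq_Re_cinner: "inner x y = Re (cinner x y)"

class chilbert_space = complex_inner + complete_space

lemma vector_space_scaleC: "vector_space ((*\<^sub>C) :: complex \<Rightarrow> 'a::complex_inner \<Rightarrow> 'a)"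
proof
  show "1 *\<^sub>C x = x" for x :: 'a
    using scaleR_scaleC[of 1 x] by simp
qed (simp_all add: scaleC_add_right scaleC_add_left scaleC_scaleC)

abbreviation csubspace :: "'a::complex_inner set \<Rightarrow> bool" where
  "csubspace \<equiv> module.subspace (*\<^sub>C)"

abbreviation cspan :: "'a::complex_inner set \<Rightarrow> 'a set" where
  "cspan \<equiv> module.span (*\<^sub>C)"

text \<open>As for every \<open>dim\<close> of the library, this is \<open>0\<close> on infinite-dimensional subspaces.\<close>

abbreviation cdim :: "'a::complex_inner set \<Rightarrow> nat" where
  "cdim \<equiv> vector_space.dim (*\<^sub>C)"

definition bounded_clinear :: "('a::complex_inner \<Rightarrow> 'a) \<Rightarrow> bool" where
  "bounded_clinear T \<longleftrightarrow> Vector_Spaces.linear (*\<^sub>C) (*\<^sub>C) T \<and> bounded_linear T"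

definition compact_operator :: "('a::complex_inner \<Rightarrow> 'a) \<Rightarrow> bool" where
  "compact_operator T \<longleftrightarrow> bounded_clinear T \<and> compact (closure (T ` cball 0 1))"

definition orthonormal_basis :: "'a::complex_inner set \<Rightarrow> bool" where
  "orthonormal_basis B \<longleftrightarrow>
     (\<forall>x\<in>B. norm x = 1) \<and> (\<forall>x\<in>B. \<forall>y\<in>B. x \<noteq> y \<longrightarrow> cinner x y = 0) \<and>
     closure (cspan B) = UNIV"


section \<open>Unbounded operators\<close>

text \<open>An unbounded operator \<open>T\<close> is a partial map; its domain is \<^term>\<open>dom T\<close>, and its value at
  \<open>x \<in> dom T\<close> is \<open>the (T x)\<close>.\<close>

definition op_linear :: "('a::complex_inner \<rightharpoonup> 'a) \<Rightarrow> bool" where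
  "op_linear T \<longleftrightarrow> csubspace (dom T) \<and>
     (\<forall>x\<in>dom T. \<forall>y\<in>dom T. the (T (x + y)) = the (T x) + the (T y)) \<and>
     (\<forall>c. \<forall>x\<in>dom T. the (T (c *\<^sub>C x)) = c *\<^sub>C the (T x))"

text \<open>For densely defined \<open>T\<close> the vector \<open>z\<close> below is unique.\<close>

definition op_adjoint :: "('a::complex_inner \<rightharpoonup> 'a) \<Rightarrow> ('a \<rightharpoonup> 'a)" where
  "op_adjoint T = (\<lambda>y.
     if \<exists>z. \<forall>x\<in>dom T. cinner y (the (T x)) = cinner z x
     then Some (THE z. \<forall>x\<in>dom T. cinner y (the (T x)) = cinner z x)
     else None)"

definition self_adjoint :: "('a::complex_inner \<rightharpoonup> 'a) \<Rightarrow> bool" where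
  "self_adjoint T \<longleftrightarrow> op_linear T \<and> closure (dom T) = UNIV \<and> op_adjoint T = T"

definition is_resolvent_at :: "('a::complex_inner \<rightharpoonup> 'a) \<Rightarrow> complex \<Rightarrow> ('a \<Rightarrow> 'a) \<Rightarrow> bool" where
  "is_resolvent_at T z R \<longleftrightarrow> bounded_clinear R \<and>
     (\<forall>y. R y \<in> dom T \<and> the (T (R y)) - z *\<^sub>C R y = y) \<and>
     (\<forall>x\<in>dom T. R (the (T x) - z *\<^sub>C x) = x)"

text \<open>By the resolvent identity, if the resolvent is compact at one point of the resolvent set then
  it is compact at all of them.\<close>

definition compact_resolvent :: "('a::complex_inner \<rightharpoonup> 'a) \<Rightarrow> bool" where
  "compact_resolvent T \<longleftrightarrow> (\<exists>z R. is_resolvent_at T z R \<and> compact_operator R)"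

definition eigenspace :: "('a::complex_inner \<rightharpoonup> 'a) \<Rightarrow> complex \<Rightarrow> 'a set" where
  "eigenspace T \<mu> = {x \<in> dom T. the (T x) = \<mu> *\<^sub>C x}"

text \<open>The sequence lists the eigenvalues of \<open>T\<close> in non-decreasing order, each real number \<open>\<mu>\<close>
  occurring as often as its multiplicity (in particular not at all if it is not an eigenvalue).
  Meant for self-adjoint \<open>T\<close> with finite-dimensional eigenspaces.\<close>

definition eigenvalue_sequence :: "('a::complex_inner \<rightharpoonup> 'a) \<Rightarrow> (nat \<Rightarrow> real) \<Rightarrow> bool" where
  "eigenvalue_sequence T ev \<longleftrightarrow> mono ev \<and>
     (\<forall>\<mu>::real. finite {n. ev n = \<mu>} \<and>
        card {n. ev n = \<mu>} = cdim (eigenspace T (complex_of_real \<mu>)))"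


section \<open>Functional calculus\<close>

text \<open>The value on non-Borel sets is fixed to be zero only to make spectral measures unique as
  functions on \<^typ>\<open>real set\<close>.\<close>

definition projection_valued_measure :: "(real set \<Rightarrow> 'a::complex_inner \<Rightarrow> 'a) \<Rightarrow> bool" where
  "projection_valued_measure E \<longleftrightarrow>
     (\<forall>B\<in>sets borel. bounded_clinear (E B) \<and> (\<forall>x. E B (E B x) = E B x) \<and>
        (\<forall>x y. cinner (E B x) y = cinner x (E B y))) \<and>
     E UNIV = id \<and>
     (\<forall>A\<in>sets borel. \<forall>B\<in>sets borel. E (A \<inter> B) = E A \<circ> E B) \<and>
     (\<forall>A :: nat \<Rightarrow> real set. range A \<subseteq> sets borel \<longrightarrow> disjoint_family A \<longrightarrow>
        (\<forall>x. (\<lambda>n. E (A n) x) sums E (\<Union>n. A n) x)) \<and>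
     (\<forall>B. B \<notin> sets borel \<longrightarrow> E B = (\<lambda>_. 0))"

definition scalar_measure :: "(real set \<Rightarrow> 'a::complex_inner \<Rightarrow> 'a) \<Rightarrow> 'a \<Rightarrow> real measure" where
  "scalar_measure E x = measure_of UNIV (sets borel) (\<lambda>B. ennreal (Re (cinner x (E B x))))"

text \<open>\<open>T = \<integral> f dE\<close> for a real-valued Borel function \<open>f\<close>. Off-diagonal matrix elements are
  determined by the diagonal ones through polarization.\<close>

definition is_spectral_integral ::
    "(real set \<Rightarrow> 'a::complex_inner \<Rightarrow> 'a) \<Rightarrow> (real \<Rightarrow> real) \<Rightarrow> ('a \<rightharpoonup> 'a) \<Rightarrow> bool" where
  "is_spectral_integral E f T \<longleftrightarrow> op_linear T \<and>
     dom T = {x. integrable (scalar_measure E x) (\<lambda>s. (f s)\<^sup>2)} \<and>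
     (\<forall>x\<in>dom T. cinner x (the (T x)) = complex_of_real (\<integral>s. f s \<partial>scalar_measure E x))"

definition spectral_measure :: "('a::complex_inner \<rightharpoonup> 'a) \<Rightarrow> real set \<Rightarrow> 'a \<Rightarrow> 'a" where
  "spectral_measure T =
     (THE E. projection_valued_measure E \<and> is_spectral_integral E (\<lambda>s. s) T)"

definition fun_calc :: "('a::complex_inner \<rightharpoonup> 'a) \<Rightarrow> (real \<Rightarrow> real) \<Rightarrow> ('a \<rightharpoonup> 'a)" where
  "fun_calc T f = (THE S. is_spectral_integral (spectral_measure T) f S)"

definition op_abs :: "('a::complex_inner \<rightharpoonup> 'a) \<Rightarrow> ('a \<rightharpoonup> 'a)" where
  "op_abs T = fun_calc T abs"

text \<open>The operators \<open>e\<^bsup>-t|D|\<^esup>\<close> (for \<open>t \<ge> 0\<close>) and \<open>\<chi>\<^bsub>[-\<lambda>,\<lambda>]\<^esub>(D)\<close> are everywhere defined.\<close>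

definition exp_abs :: "('a::complex_inner \<rightharpoonup> 'a) \<Rightarrow> real \<Rightarrow> 'a \<Rightarrow> 'a" where
  "exp_abs D t = (\<lambda>x. the (fun_calc (op_abs D) (\<lambda>s. exp (- t * s)) x))"

definition spectral_proj :: "('a::complex_inner \<rightharpoonup> 'a) \<Rightarrow> real \<Rightarrow> 'a \<Rightarrow> 'a" where
  "spectral_proj D l = (\<lambda>x. the (fun_calc D (indicator {-l..l}) x))"


section \<open>Traces\<close>

text \<open>The two traces below do not depend on the orthonormal basis when \<open>T\<close> is positive,
  respectively trace class.\<close>

definition some_onb :: "'a::complex_inner set" where
  "some_onb = (SOME B. orthonormal_basis B)"

definition pos_trace :: "('a::complex_inner \<Rightarrow> 'a) \<Rightarrow> ennreal" where
  "pos_trace T = (\<Sum>\<^sub>\<infinity>e\<in>some_onb. ennreal (Re (cinner e (T e))))"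

definition op_trace :: "('a::complex_inner \<Rightarrow> 'a) \<Rightarrow> complex" where
  "op_trace T = (\<Sum>\<^sub>\<infinity>e\<in>some_onb. cinner e (T e))"


section \<open>Extended limits\<close>

text \<open>States on the bounded complex sequences which vanish on null sequences. The values
  on unbounded sequences are irrelevant.\<close>

definition linf_state :: "((nat \<Rightarrow> complex) \<Rightarrow> complex) \<Rightarrow> bool" where
  "linf_state \<omega> \<longleftrightarrow>
     (\<forall>x y. Bseq x \<longrightarrow> Bseq y \<longrightarrow> \<omega> (\<lambda>n. x n + y n) = \<omega> x + \<omega> y) \<and>
     (\<forall>c x. Bseq x \<longrightarrow> \<omega> (\<lambda>n. c * x n) = c * \<omega> x) \<and>
     (\<forall>x. Bseq x \<longrightarrow> (\<forall>n. x n \<in> \<real>\<^sub>\<ge>\<^sub>0) \<longrightarrow> \<omega> x \<in> \<real>\<^sub>\<ge>\<^sub>0) \<and>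
     \<omega> (\<lambda>_. 1) = 1"

definition extended_limit :: "((nat \<Rightarrow> complex) \<Rightarrow> complex) \<Rightarrow> bool" where
  "extended_limit \<omega> \<longleftrightarrow> linf_state \<omega> \<and> (\<forall>x. x \<longlonglongrightarrow> 0 \<longrightarrow> \<omega> x = 0)"

end

theory Submission
  imports Defs
begin

text \<open>
  Write \<open>D = \<Sum>\<^sub>k \<mu>\<^sub>k \<langle>b\<^sub>k, \<cdot>\<rangle> b\<^sub>k\<close> in an orthonormal eigenbasis, numbered so that \<open>\<lambda>\<^sub>k = \<bar>\<mu>\<^sub>k\<bar>\<close> is
  non-decreasing, and put \<open>a\<^sub>k = \<langle>b\<^sub>k, a b\<^sub>k\<rangle>\<close>. Then \<open>Tr (a e\<^bsup>-t\<bar>D\<bar>\<^esup>) = \<Sum>\<^sub>k e\<^bsup>-t\<lambda>\<^sub>k\<^esup> a\<^sub>k\<close>, and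
  \<open>Tr (P\<^sub>\<lambda> a P\<^sub>\<lambda>)\<close> is the sum of those \<open>a\<^sub>k\<close> with \<open>\<lambda>\<^sub>k \<le> \<lambda>\<close>. Summation by parts expresses the first
  family through the second: with \<open>x\<^sub>n = Tr (P a P) / Tr P\<close> for \<open>P = P\<^bsub>\<lambda>\<^sub>n\<^esub>\<close> and \<open>Z(t) = Tr e\<^bsup>-t\<bar>D\<bar>\<^esup>\<close>,
  \<open>Tr (a e\<^bsup>-t\<bar>D\<bar>\<^esup>) / Z(t) = \<Sum>\<^sub>n p\<^sub>t(n) x\<^sub>n\<close> with \<open>p\<^sub>t(n) = (n + 1) (e\<^bsup>-t\<lambda>\<^sub>n\<^esup> - e\<^bsup>-t\<lambda>\<^sub>n\<^sub>+\<^sub>1\<^esup>) / Z(t)\<close>.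
  Repeated eigenvalues do no harm, because the weight \<open>p\<^sub>t(n)\<close> vanishes unless
  \<open>\<lambda>\<^sub>n < \<lambda>\<^sub>n\<^sub>+\<^sub>1\<close>, and then exactly \<open>n + 1\<close> of the \<open>\<lambda>\<^sub>k\<close> are at most \<open>\<lambda>\<^sub>n\<close>
  (\<open>Abel_weight_average\<close>).

  The \<open>p\<^sub>t(n)\<close> are nonnegative with sum \<open>1\<close>, and each of them tends to \<open>0\<close> as \<open>t\<close> decreases to
  \<open>\<beta>\<close>, because its numerator stays bounded while \<open>Z(t)\<close> tends to infinity. They therefore form a
  regular summation method in the sense of Toeplitz. It preserves limits (\<open>Toeplitz_regular\<close>),
  which gives the second claim, and composing an extended limit with it gives an extended limit
  that depends on \<open>D\<close> and \<open>\<beta>\<close> but not on \<open>a\<close> (\<open>extended_limit_Toeplitz\<close>), which gives the first.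

  Before this argument can start, the operators have to be identified with diagonal ones. An
  eigenbasis exists because \<open>\<parallel>(D - z)\<^sup>-\<^sup>1 y\<parallel>\<close> attains its maximum on the unit vectors orthogonal to
  the eigenvectors already found (\<open>eigenvector_in_orthogonal_complement\<close>). The functional calculus
  is described through a spectral measure that is only characterized by its properties, so it must
  be shown that a diagonal operator has no spectral measure besides the obvious one
  (\<open>pvm_eq_diag_pvm\<close>). Finally the traces are defined by a fixed orthonormal basis that has nothing
  to do with \<open>D\<close>; exchanging the order of summation moves them to the eigenbasis
  (\<open>op_trace_comp_diag_op\<close>).
\<close>

section \<open>Complex Hilbert spaces and orthonormal expansions\<close>

instance chilbert_space \<subseteq> banach ..

interpretation complex_vector: vector_space "scaleC :: complex \<Rightarrow> 'a::complex_inner \<Rightarrow> 'a"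
  by (rule vector_space_scaleC)

lemma cinner_add_left: "cinner (x + y) z = cinner x z + cinner y z"
  by (metis cinner_add_right cinner_commute complex_cnj_add)

lemma cinner_scaleC_left: "cinner (c *\<^sub>C x) y = cnj c * cinner x y"
  by (metis cinner_commute cinner_scaleC_right complex_cnj_mult)

lemma cinner_self: "cinner x x = complex_of_real ((norm x)\<^sup>2)"
proof -
  have "Im (cinner x x) = 0"
    by (metis cinner_commute cnj.simps(2) equation_minus_iff neg_equal_0_iff_equal
        equal_neg_zero)
  moreover have "Re (cinner x x) = (norm x)\<^sup>2"
    by (metis inner_eq_Re_cinner power2_norm_eq_inner)
  ultimately show ?thesis by (simp add: complex_eq_iff)
qed

lemma of_real_cmod_square: "(complex_of_real (cmod z))\<^sup>2 = z * cnj z"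
  by (metis complex_norm_square of_real_power)

lemma norm_scaleC: "norm (c *\<^sub>C x) = cmod c * norm (x::'a::complex_inner)"
proof -
  have "complex_of_real ((norm (c *\<^sub>C x))\<^sup>2) = cnj c * c * complex_of_real ((norm x)\<^sup>2)"
    unfolding cinner_self[symmetric] by (simp add: cinner_scaleC_left cinner_scaleC_right)
  also have "\<dots> = complex_of_real ((cmod c * norm x)\<^sup>2)"
    by (simp add: of_real_cmod_square power_mult_distrib mult.commute)
  finally have "(norm (c *\<^sub>C x))\<^sup>2 = (cmod c * norm x)\<^sup>2"
    using of_real_eq_iff by blast
  then show ?thesis by simp
qed

text \<open>Multiplying \<open>y\<close> by a suitable phase makes the inner product a nonnegative real number, and then
  the inequality is the real one.\<close>

lemma cinner_Cauchy_Schwarz: "cmod (cinner x y) \<le> norm x * norm y"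
proof (cases "cinner x y = 0")
  case False
  define c where "c = cnj (sgn (cinner x y))"
  have "cmod c = 1" using False by (simp add: c_def norm_sgn)
  have "c * cinner x y = complex_of_real (cmod (cinner x y))"
    using False by (simp add: c_def sgn_eq complex_norm_square[symmetric] field_simps power2_eq_square
        flip: of_real_mult)
  then have "cmod (cinner x y) = Re (cinner x (c *\<^sub>C y))"
    by (simp add: cinner_scaleC_right)
  also have "\<dots> \<le> norm x * norm (c *\<^sub>C y)"
    by (metis inner_eq_Re_cinner norm_cauchy_schwarz)
  finally show ?thesis using \<open>cmod c = 1\<close> by (simp add: norm_scaleC)
qed simp

interpretation cinner: bounded_bilinear "cinner :: 'a::complex_inner \<Rightarrow> 'a \<Rightarrow> complex"
  by standard (auto simp: cinner_add_left cinner_add_right scaleR_scaleC cinner_scaleC_left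
      cinner_scaleC_right scaleR_conv_of_real intro!: exI[of _ 1] cinner_Cauchy_Schwarz)

interpretation scaleC: bounded_bilinear "scaleC :: complex \<Rightarrow> 'a::complex_inner \<Rightarrow> 'a"
  by standard (auto simp: scaleC_add_left scaleC_add_right scaleR_scaleC
      scaleC_scaleC norm_scaleC scaleR_conv_of_real mult.commute intro!: exI[of _ 1])

lemma bounded_clinear_iff:
  "bounded_clinear T \<longleftrightarrow> bounded_linear T \<and> (\<forall>c x. T (c *\<^sub>C x) = c *\<^sub>C T x)"
proof -
  have "T (x + y) = T x + T y" if "bounded_linear T" for x y
    using that by (simp add: bounded_linear.linear linear_add)
  then show ?thesis
    unfolding bounded_clinear_def Vector_Spaces.linear_def module_hom_def module_hom_axioms_def
    using vector_space_scaleC complex_vector.module_axioms by blast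
qed

lemma bounded_clinear_comp:
  assumes "bounded_clinear S" "bounded_clinear T" shows "bounded_clinear (S \<circ> T)"
  using assms by (auto simp: bounded_clinear_iff comp_def intro: bounded_linear_compose)

lemma bounded_clinear_ident: "bounded_clinear (\<lambda>x. x)"
  by (simp add: bounded_clinear_iff)

definition orthonormal :: "'a::complex_inner set \<Rightarrow> bool" where
  "orthonormal B \<longleftrightarrow> (\<forall>x\<in>B. \<forall>y\<in>B. cinner x y = (if x = y then 1 else 0))"

lemma orthonormal_basis_iff: "orthonormal_basis B \<longleftrightarrow> orthonormal B \<and> closure (cspan B) = UNIV"
proof -
  have "norm x = 1 \<longleftrightarrow> cinner x x = 1" for x :: 'a
    by (metis cinner_self norm_eq_1 norm_eq_sqrt_inner of_real_1 of_real_eq_iff power2_norm_eq_inner)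
  then show ?thesis unfolding orthonormal_basis_def orthonormal_def by auto
qed

lemma orthonormal_norm: "orthonormal B \<Longrightarrow> b \<in> B \<Longrightarrow> norm b = 1"
  unfolding orthonormal_def
  by (metis cinner_self norm_eq_1 of_real_1 of_real_eq_iff power2_norm_eq_inner)

lemma orthonormal_cinner_sum:
  assumes "orthonormal B" "finite F" "F \<subseteq> B" "b \<in> B"
  shows "cinner b (\<Sum>a\<in>F. c a *\<^sub>C a) = (if b \<in> F then c b else 0)"
proof -
  have "cinner b (\<Sum>a\<in>F. c a *\<^sub>C a) = (\<Sum>a\<in>F. if a = b then c b else 0)"
    unfolding cinner.sum_right
    by (rule sum.cong) (use assms in \<open>auto simp: orthonormal_def cinner_scaleC_right subset_iff\<close>)
  then show ?thesis using assms(2) by simp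
qed

lemma norm_sum_orthonormal:
  assumes "orthonormal B" "finite F" "F \<subseteq> B"
  shows "(norm (\<Sum>b\<in>F. c b *\<^sub>C b))\<^sup>2 = (\<Sum>b\<in>F. (cmod (c b))\<^sup>2)"
proof -
  have "complex_of_real ((norm (\<Sum>b\<in>F. c b *\<^sub>C b))\<^sup>2)
      = (\<Sum>b\<in>F. cnj (c b) * cinner b (\<Sum>a\<in>F. c a *\<^sub>C a))"
    unfolding cinner_self[symmetric] cinner.sum_left by (simp add: cinner_scaleC_left)
  also have "\<dots> = (\<Sum>b\<in>F. complex_of_real ((cmod (c b))\<^sup>2))"
    by (rule sum.cong) (use assms in \<open>auto simp: orthonormal_cinner_sum[OF assms] subset_iff
        of_real_cmod_square mult.commute\<close>)
  finally show ?thesis using of_real_eq_iff unfolding of_real_sum[symmetric] by blast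
qed

lemma Bessel_finite:
  assumes "orthonormal B" "finite F" "F \<subseteq> B"
  shows "(\<Sum>b\<in>F. (cmod (cinner b x))\<^sup>2) \<le> (norm x)\<^sup>2"
proof -
  define s where "s = (\<Sum>b\<in>F. cinner b x *\<^sub>C b)"
  have ss: "(norm s)\<^sup>2 = (\<Sum>b\<in>F. (cmod (cinner b x))\<^sup>2)"
    unfolding s_def by (rule norm_sum_orthonormal[OF assms])
  have "cinner x s = (\<Sum>b\<in>F. complex_of_real ((cmod (cinner b x))\<^sup>2))"
    unfolding s_def cinner.sum_right
    by (rule sum.cong[OF refl])
      (simp add: cinner_scaleC_right of_real_cmod_square cinner_commute[of x])
  then have "inner x s = (norm s)\<^sup>2"
    unfolding ss inner_eq_Re_cinner by (simp flip: of_real_sum)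
  moreover have "0 \<le> (norm (x - s))\<^sup>2" by simp
  ultimately show ?thesis
    unfolding ss[symmetric] by (simp add: power2_norm_eq_inner inner_diff inner_commute)
qed

lemma Bessel_summable:
  assumes "orthonormal B"
  shows "(\<lambda>b. (cmod (cinner b x))\<^sup>2) summable_on B"
  by (rule nonneg_bdd_above_summable_on)
    (auto intro!: bdd_aboveI2[where M="(norm x)\<^sup>2"] Bessel_finite[OF assms])

text \<open>By Pythagoras the squared distance between nested partial sums is a difference of partial sums of
  \<open>\<bar>c\<^sub>b\<bar>\<^sup>2\<close>, so the net of partial sums is Cauchy. The series converges unconditionally but in
  general not absolutely, so the argument has to be made with the squares.\<close>

lemma summable_orthonormal:
  fixes B :: "'a::chilbert_space set"
  assumes B: "orthonormal B" and c: "(\<lambda>b. (cmod (c b))\<^sup>2) summable_on B"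
  shows "(\<lambda>b. c b *\<^sub>C b) summable_on B"
proof -
  define s where "s F = (\<Sum>b\<in>F. c b *\<^sub>C b)" for F
  define g where "g F = (\<Sum>b\<in>F. (cmod (c b))\<^sup>2)" for F
  obtain L where L: "(g \<longlongrightarrow> L) (finite_subsets_at_top B)"
    using c unfolding summable_on_def has_sum_def g_def by blast
  have "\<exists>P. eventually P (finite_subsets_at_top B) \<and>
      (\<forall>F F'. P F \<and> P F' \<longrightarrow> dist (s F) (s F') < e)" if "e > 0" for e
  proof -
    define d where "d = (e/2)\<^sup>2 / 2"
    have "d > 0" using that by (simp add: d_def)
    then have "eventually (\<lambda>F. dist (g F) L < d) (finite_subsets_at_top B)"
      using L by (simp add: tendsto_iff)
    then obtain F0 where F0: "finite F0" "F0 \<subseteq> B"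
        "\<And>F. finite F \<Longrightarrow> F0 \<subseteq> F \<Longrightarrow> F \<subseteq> B \<Longrightarrow> dist (g F) L < d"
      unfolding eventually_finite_subsets_at_top by metis
    have near: "dist (s F) (s F0) < e/2" if F: "finite F" "F0 \<subseteq> F" "F \<subseteq> B" for F
    proof -
      have "(norm (s F - s F0))\<^sup>2 = g (F - F0)"
      proof -
        have "s F - s F0 = s (F - F0)" unfolding s_def using F by (simp add: sum_diff)
        then show ?thesis unfolding s_def g_def
          using norm_sum_orthonormal[OF B, of "F - F0" c] F by auto
      qed
      also have "\<dots> = g F - g F0" unfolding g_def using F by (simp add: sum_diff)
      also have "\<dots> < 2 * d"
        using F0(3)[OF F] F0(3)[OF F0(1) order_refl F0(2)] by (simp add: dist_real_def)
      also have "\<dots> = (e/2)\<^sup>2" by (simp add: d_def)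
      finally show ?thesis using power_less_imp_less_base[of "norm (s F - s F0)" 2 "e/2"] \<open>e > 0\<close>
        unfolding dist_norm by linarith
    qed
    show ?thesis
    proof (intro exI conjI allI impI)
      show "eventually (\<lambda>F. finite F \<and> F0 \<subseteq> F \<and> F \<subseteq> B) (finite_subsets_at_top B)"
        using F0 by (auto simp: eventually_finite_subsets_at_top)
      fix F F' assume "(finite F \<and> F0 \<subseteq> F \<and> F \<subseteq> B) \<and> finite F' \<and> F0 \<subseteq> F' \<and> F' \<subseteq> B"
      then show "dist (s F) (s F') < e"
        using near[of F] near[of F'] dist_triangle2[of "s F" "s F'" "s F0"] by linarith
    qed
  qed
  then have "cauchy_filter (filtermap s (finite_subsets_at_top B))"
    by (simp add: cauchy_filter_metric_filtermap)
  moreover have "complete (UNIV::'a set)"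
    by (meson Cauchy_convergent UNIV_I complete_def convergent_def)
  ultimately obtain L' where "(s \<longlongrightarrow> L') (finite_subsets_at_top B)"
    using complete_uniform[where S=UNIV] by (force simp add: filterlim_def)
  then show ?thesis unfolding summable_on_def has_sum_def s_def by blast
qed

lemma orthonormal_coefficient:
  fixes B :: "'a::complex_inner set"
  assumes B: "orthonormal B" and s: "((\<lambda>b. c b *\<^sub>C b) has_sum s) B" and b: "b \<in> B"
  shows "cinner b s = c b"
proof -
  have "((\<lambda>a. cinner b (c a *\<^sub>C a)) has_sum cinner b s) B"
    by (rule has_sum_bounded_linear[OF cinner.bounded_linear_right s])
  moreover have "((\<lambda>a. cinner b (c a *\<^sub>C a)) has_sum c b) B"
    by (rule has_sum_finite_neutralI[of "{b}"])
      (use B b in \<open>auto simp: cinner_scaleC_right orthonormal_def\<close>)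
  ultimately show ?thesis using has_sum_unique by blast
qed

text \<open>The vectors orthogonal to \<open>x\<close> form a closed subspace; if it contains a basis it contains \<open>x\<close>.\<close>

lemma orthonormal_basis_total:
  assumes "orthonormal_basis B" "\<And>b. b \<in> B \<Longrightarrow> cinner b x = 0"
  shows "x = 0"
proof -
  have "cspan B \<subseteq> {y. cinner y x = 0}"
    by (rule complex_vector.span_minimal)
      (use assms in \<open>auto simp: complex_vector.subspace_def cinner_add_left cinner_scaleC_left cinner.zero_left\<close>)
  moreover have "closed {y. cinner y x = 0}"
    by (intro closed_Collect_eq continuous_on_const
        bounded_linear.continuous_on[OF cinner.bounded_linear_left continuous_on_id])
  ultimately have "closure (cspan B) \<subseteq> {y. cinner y x = 0}"
    by (rule closure_minimal)
  then have "cinner x x = 0" using assms(1) by (auto simp: orthonormal_basis_iff)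
  then show ?thesis by (simp add: cinner_self)
qed

text \<open>The sum \<open>s\<close> is the orthogonal projection of \<open>x\<close> onto the closed span of \<open>B\<close>.\<close>

lemma Bessel_sum_exists:
  fixes B :: "'a::chilbert_space set"
  assumes "orthonormal B"
  obtains s where "((\<lambda>b. cinner b x *\<^sub>C b) has_sum s) B" "\<And>b. b \<in> B \<Longrightarrow> cinner b (x - s) = 0"
proof -
  obtain s where s: "((\<lambda>b. cinner b x *\<^sub>C b) has_sum s) B"
    using summable_orthonormal[OF assms Bessel_summable[OF assms]] by (auto simp: summable_on_def)
  show ?thesis
    by (rule that[OF s]) (simp add: cinner.diff_right orthonormal_coefficient[OF assms s])
qed

lemma orthonormal_basis_expansion:
  fixes B :: "'a::chilbert_space set"
  assumes "orthonormal_basis B"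
  shows "((\<lambda>b. cinner b x *\<^sub>C b) has_sum x) B"
proof -
  obtain s where s: "((\<lambda>b. cinner b x *\<^sub>C b) has_sum s) B" "\<And>b. b \<in> B \<Longrightarrow> cinner b (x - s) = 0"
    using Bessel_sum_exists assms unfolding orthonormal_basis_iff by metis
  then have "x - s = 0" using orthonormal_basis_total[OF assms] by blast
  then show ?thesis using s(1) by simp
qed

lemma has_sum_in_closure_cspan:
  fixes B :: "'a::complex_inner set"
  assumes "((\<lambda>b. c b *\<^sub>C b) has_sum s) B"
  shows "s \<in> closure (cspan B)"
proof (rule Lim_in_closed_set)
  show "((\<lambda>F. \<Sum>b\<in>F. c b *\<^sub>C b) \<longlongrightarrow> s) (finite_subsets_at_top B)"
    using assms unfolding has_sum_def .
  show "\<forall>\<^sub>F F in finite_subsets_at_top B. (\<Sum>b\<in>F. c b *\<^sub>C b) \<in> closure (cspan B)"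
    by (rule eventually_finite_subsets_at_top_weakI)
      (blast intro: subsetD[OF closure_subset] complex_vector.span_sum complex_vector.span_scale
        complex_vector.span_base)
qed auto

lemma orthonormal_basisI:
  fixes B :: "'a::chilbert_space set"
  assumes B: "orthonormal B" and total: "\<And>x. (\<And>b. b \<in> B \<Longrightarrow> cinner b x = 0) \<Longrightarrow> x = 0"
  shows "orthonormal_basis B"
proof -
  have "x \<in> closure (cspan B)" for x
  proof -
    obtain s where s: "((\<lambda>b. cinner b x *\<^sub>C b) has_sum s) B" "\<And>b. b \<in> B \<Longrightarrow> cinner b (x - s) = 0"
      using Bessel_sum_exists[OF B] by metis
    then have "x = s" using total[of "x - s"] by auto
    then show ?thesis using has_sum_in_closure_cspan[OF s(1)] by simp
  qed
  then show ?thesis using B by (auto simp: orthonormal_basis_iff)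
qed

lemma Parseval:
  fixes B :: "'a::chilbert_space set"
  assumes "orthonormal_basis B"
  shows "((\<lambda>b. cinner x b * cinner b y) has_sum cinner x y) B"
  using has_sum_bounded_linear[OF cinner.bounded_linear_right[of x]
      orthonormal_basis_expansion[OF assms, of y]]
  by (simp add: cinner_scaleC_right mult.commute)

lemma Parseval_norm:
  fixes B :: "'a::chilbert_space set"
  assumes "orthonormal_basis B"
  shows "((\<lambda>b. (cmod (cinner b x))\<^sup>2) has_sum (norm x)\<^sup>2) B"
proof -
  have "cinner x b * cinner b x = complex_of_real ((cmod (cinner b x))\<^sup>2)" for b
    by (metis cinner_commute complex_norm_square mult.commute)
  then have "((\<lambda>b. complex_of_real ((cmod (cinner b x))\<^sup>2)) has_sum complex_of_real ((norm x)\<^sup>2)) B"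
    using Parseval[OF assms, of x x] by (simp only: cinner_self)
  then show ?thesis by (simp only: has_sum_of_real_iff)
qed

section \<open>Eigenbases of self-adjoint operators with compact resolvent\<close>

lemma dense_cinner_eq_0:
  assumes "closure S = UNIV" "\<And>x. x \<in> S \<Longrightarrow> cinner z x = 0"
  shows "z = (0::'a::complex_inner)"
proof -
  have "closed {x. cinner z x = 0}"
    by (intro closed_Collect_eq continuous_on_const
        bounded_linear.continuous_on[OF cinner.bounded_linear_right continuous_on_id])
  then have "closure S \<subseteq> {x. cinner z x = 0}"
    by (rule closure_minimal[rotated]) (use assms(2) in auto)
  then have "cinner z z = 0" using assms(1) by auto
  then show ?thesis by (simp add: cinner_self)
qed

text \<open>Self-adjointness as a test: whenever \<open>z\<close> behaves on the domain like \<open>T y\<close> should, \<open>y\<close> is in the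
  domain and \<open>T y = z\<close>. New elements of the domain are found in this way only.\<close>

lemma self_adjoint_iff_Some:
  assumes "self_adjoint T"
  shows "T y = Some z \<longleftrightarrow> (\<forall>x\<in>dom T. cinner y (the (T x)) = cinner z x)" (is "_ \<longleftrightarrow> ?P z")
proof -
  have uniq: "z' = z" if "?P z" "?P z'" for z z'
    using dense_cinner_eq_0[of "dom T" "z' - z"] assms that
    by (auto simp: self_adjoint_def cinner.diff_left)
  have "op_adjoint T y = Some z \<longleftrightarrow> ?P z"
  proof
    assume *: "op_adjoint T y = Some z"
    then obtain z' where z': "?P z'" by (auto simp: op_adjoint_def split: if_splits)
    then have ex: "\<exists>z. ?P z" by blast
    have z: "z = (THE z. ?P z)" using *[symmetric] unfolding op_adjoint_def if_P[OF ex] option.inject .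
    have "?P (THE z. ?P z)" by (rule theI[of ?P, OF z']) (rule uniq[OF z'])
    then show "?P z" by (subst z)
  next
    assume *: "?P z"
    then have "(THE z. ?P z) = z" using uniq by (intro the_equality) auto
    then show "op_adjoint T y = Some z" unfolding op_adjoint_def using * by auto
  qed
  then show ?thesis using assms by (simp add: self_adjoint_def)
qed

lemma self_adjoint_symmetric:
  assumes "self_adjoint T" "x \<in> dom T" "y \<in> dom T"
  shows "cinner y (the (T x)) = cinner (the (T y)) x"
  using self_adjoint_iff_Some[OF assms(1), of y "the (T y)"] assms(2,3) by auto

lemma op_linear_simps:
  assumes "op_linear T"
  shows "0 \<in> dom T" "the (T 0) = 0"
    and "x \<in> dom T \<Longrightarrow> c *\<^sub>C x \<in> dom T" "x \<in> dom T \<Longrightarrow> the (T (c *\<^sub>C x)) = c *\<^sub>C the (T x)"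
    and "x \<in> dom T \<Longrightarrow> y \<in> dom T \<Longrightarrow> x + y \<in> dom T"
    and "x \<in> dom T \<Longrightarrow> y \<in> dom T \<Longrightarrow> the (T (x + y)) = the (T x) + the (T y)"
    and "x \<in> dom T \<Longrightarrow> y \<in> dom T \<Longrightarrow> x - y \<in> dom T"
    and "x \<in> dom T \<Longrightarrow> y \<in> dom T \<Longrightarrow> the (T (x - y)) = the (T x) - the (T y)"
proof -
  have sub: "csubspace (dom T)" using assms by (simp add: op_linear_def)
  show 0: "0 \<in> dom T" by (rule complex_vector.subspace_0[OF sub])
  have scale: "the (T (c *\<^sub>C x)) = c *\<^sub>C the (T x)" if "x \<in> dom T" for x c
    using assms that unfolding op_linear_def by blast
  have add: "the (T (x + y)) = the (T x) + the (T y)" if "x \<in> dom T" "y \<in> dom T" for x y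
    using assms that unfolding op_linear_def by blast
  show "the (T 0) = 0" using scale[OF 0, of 0] by (simp add: scaleC.zero_left)
  show "x \<in> dom T \<Longrightarrow> c *\<^sub>C x \<in> dom T" by (rule complex_vector.subspace_scale[OF sub])
  show "x \<in> dom T \<Longrightarrow> the (T (c *\<^sub>C x)) = c *\<^sub>C the (T x)" by (rule scale)
  show "x \<in> dom T \<Longrightarrow> y \<in> dom T \<Longrightarrow> x + y \<in> dom T" by (rule complex_vector.subspace_add[OF sub])
  show "x \<in> dom T \<Longrightarrow> y \<in> dom T \<Longrightarrow> the (T (x + y)) = the (T x) + the (T y)" by (rule add)
  assume xy: "x \<in> dom T" "y \<in> dom T"
  show d: "x - y \<in> dom T" by (rule complex_vector.subspace_diff[OF sub xy])
  show "the (T (x - y)) = the (T x) - the (T y)" using add[OF d xy(2)] by simp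
qed

text \<open>A maximizing sequence of unit vectors \<open>y\<^sub>n\<close> can be chosen such that \<open>R y\<^sub>n\<close> converges. Then
  \<open>\<parallel>R (y\<^sub>m + y\<^sub>n)\<parallel>\<close> is almost twice the supremum, so \<open>\<parallel>y\<^sub>m + y\<^sub>n\<parallel>\<close> is almost \<open>2\<close>, and the parallelogram
  law forces \<open>y\<^sub>m - y\<^sub>n\<close> to be small. Hence \<open>y\<^sub>n\<close> itself converges, and weak compactness of the unit
  ball is avoided.\<close>

lemma compact_norm_attained:
  fixes R :: "'a::{real_inner,complete_space} \<Rightarrow> 'b::real_normed_vector"
  assumes R: "bounded_linear R" and cpt: "compact (closure (R ` cball 0 1))"
    and M: "closed M" "subspace M" and x0: "x0 \<in> M" "R x0 \<noteq> 0"
  obtains y where "y \<in> M" "norm y = 1" "R y \<noteq> 0" "\<And>k. k \<in> M \<Longrightarrow> norm (R k) \<le> norm (R y) * norm k"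
proof -
  interpret R: bounded_linear R by (rule R)
  obtain K where K: "\<And>x. norm (R x) \<le> norm x * K" using R.bounded by blast
  define V where "V = {norm (R k) |k. k \<in> M \<and> norm k = 1}"
  define r where "r = Sup V"
  have bdd: "bdd_above V" unfolding V_def by (rule bdd_aboveI[of _ K]) (use K in \<open>clarsimp, metis mult_1\<close>)
  have x0': "x0 \<noteq> 0" using x0(2) R.zero by auto
  have scaled: "norm (R k) = norm (R ((1 / norm k) *\<^sub>R k)) * norm k \<and> norm (R ((1 / norm k) *\<^sub>R k)) \<in> V"
    if "k \<in> M" "k \<noteq> 0" for k
    using that M(2) by (auto simp: V_def R.scaleR intro!: exI[of _ "(1 / norm k) *\<^sub>R k"] subspace_scale)
  have le: "norm (R k) \<le> r * norm k" if "k \<in> M" for k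
  proof (cases "k = 0")
    case False
    then show ?thesis using scaled[OF that False] cSup_upper[OF _ bdd]
      by (auto simp: r_def intro: mult_right_mono)
  qed (simp add: R.zero)
  have r: "r > 0"
  proof -
    have "0 < r * norm x0" using le[OF x0(1)] x0(2) by (smt (verit) zero_less_norm_iff)
    then show ?thesis by (simp add: zero_less_mult_iff x0')
  qed
  have "V \<noteq> {}" using scaled[OF x0(1) x0'] by auto
  have "\<exists>y. y \<in> M \<and> norm y = 1 \<and> r - 1 / Suc n < norm (R y)" for n
    using less_cSup_iff[OF \<open>V \<noteq> {}\<close> bdd, of "r - 1 / Suc n"] by (auto simp: r_def V_def)
  then obtain y where y: "\<And>n. y n \<in> M" "\<And>n. norm (y n) = 1" "\<And>n. r - 1 / Suc n < norm (R (y n))"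
    by metis
  have "\<forall>n. R (y n) \<in> closure (R ` cball 0 1)"
    using y(2) by (auto intro!: subsetD[OF closure_subset])
  then obtain l s where s: "strict_mono s" and l: "((\<lambda>n. R (y n)) \<circ> s) \<longlonglongrightarrow> l"
    using cpt unfolding compact_def by metis
  have lim_norm: "(\<lambda>n. norm (R (y n))) \<longlonglongrightarrow> r"
  proof (rule tendsto_sandwich[OF _ _ _ tendsto_const])
    show "\<forall>\<^sub>F n in sequentially. r - 1 / Suc n \<le> norm (R (y n))"
      by (intro always_eventually allI less_imp_le y(3))
    show "\<forall>\<^sub>F n in sequentially. norm (R (y n)) \<le> r" using le[OF y(1)] y(2) by auto
    show "(\<lambda>n. r - 1 / real (Suc n)) \<longlonglongrightarrow> r"
      using tendsto_diff[OF tendsto_const[of r] LIMSEQ_Suc[OF lim_1_over_n]] by simp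
  qed
  have nl: "norm l = r"
    using LIMSEQ_unique[OF tendsto_norm[OF l]] LIMSEQ_subseq_LIMSEQ[OF lim_norm s]
    by (simp add: comp_def)
  have "Cauchy (y \<circ> s)"
  proof (rule metric_CauchyI)
    fix e :: real assume e: "e > 0"
    \<comment> \<open>The parallelogram law will give \<open>r\<^sup>2 \<parallel>y\<^sub>m - y\<^sub>n\<parallel>\<^sup>2 < 8 d r\<close>. The bound \<open>d \<le> r\<close> keeps \<open>2 (r - d)\<close>
      nonnegative, so that it may be squared.\<close>
    define d where "d = min r (e\<^sup>2 * r / 8)"
    have d: "d > 0" "d \<le> r" "8 * d \<le> e\<^sup>2 * r" using e r by (auto simp: d_def)
    obtain N where N: "\<And>n. n \<ge> N \<Longrightarrow> norm (R (y (s n)) - l) < d"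
      using LIMSEQ_D[OF l d(1)] by auto
    have "dist (y (s m)) (y (s n)) < e" if "m \<ge> N" "n \<ge> N" for m n
    proof -
      let ?a = "y (s m)" and ?b = "y (s n)"
      have "2 * r = norm (2 *\<^sub>R l)" using nl by simp
      also have "2 *\<^sub>R l = (R ?a + R ?b) - ((R ?a - l) + (R ?b - l))" by (simp add: scaleR_2)
      also have "norm \<dots> \<le> norm (R ?a + R ?b) + (norm (R ?a - l) + norm (R ?b - l))"
        by (meson add_left_mono norm_triangle_ineq norm_triangle_ineq4 order_trans)
      also have "\<dots> < norm (R ?a + R ?b) + 2 * d" using N[OF that(1)] N[OF that(2)] by linarith
      also have "norm (R ?a + R ?b) \<le> r * norm (?a + ?b)"
        using le[OF subspace_add[OF M(2) y(1) y(1)]] by (simp add: R.add)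
      finally have "2 * (r - d) < r * norm (?a + ?b)" by simp
      then have "(2 * (r - d))\<^sup>2 < (r * norm (?a + ?b))\<^sup>2" using d by (intro power_strict_mono) auto
      moreover have "(norm (?a + ?b))\<^sup>2 + (norm (?a - ?b))\<^sup>2 = 4"
        using y(2) by (simp add: power2_norm_eq_inner inner_add inner_diff inner_commute norm_eq_1)
      then have "r\<^sup>2 * (norm (?a + ?b))\<^sup>2 + r\<^sup>2 * (norm (?a - ?b))\<^sup>2 = r\<^sup>2 * 4"
        by (simp only: distrib_left[symmetric])
      ultimately have "(2 * (r - d))\<^sup>2 + r\<^sup>2 * (norm (?a - ?b))\<^sup>2 < 4 * r\<^sup>2"
        unfolding power_mult_distrib[of r] by linarith
      then have "r\<^sup>2 * (norm (?a - ?b))\<^sup>2 < 8 * d * r - 4 * d\<^sup>2"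
        by (simp add: power2_eq_square algebra_simps)
      also have "\<dots> \<le> (8 * d) * r" by simp
      also have "\<dots> \<le> e\<^sup>2 * r * r" using d(3) r by (intro mult_right_mono) auto
      finally have "r\<^sup>2 * (norm (?a - ?b))\<^sup>2 < r\<^sup>2 * e\<^sup>2" by (simp add: power2_eq_square mult_ac)
      then have "(norm (?a - ?b))\<^sup>2 < e\<^sup>2" using r by simp
      then show ?thesis using e power_less_imp_less_base[of "norm (?a - ?b)" 2 e] by (simp add: dist_norm)
    qed
    then show "\<exists>N. \<forall>m\<ge>N. \<forall>n\<ge>N. dist ((y \<circ> s) m) ((y \<circ> s) n) < e" by auto
  qed
  then obtain z where z: "(y \<circ> s) \<longlonglongrightarrow> z" using Cauchy_convergent convergent_def by blast
  have "z \<in> M" by (rule closed_sequentially[OF M(1) _ z]) (simp add: y)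
  moreover have "norm z = 1"
    using LIMSEQ_unique[OF tendsto_norm[OF z], of 1] y(2) by (simp add: comp_def)
  moreover have "R z = l"
    using LIMSEQ_unique[OF R.tendsto[OF z]] l by (simp add: comp_def)
  ultimately show ?thesis using that[of z] le nl r by auto
qed

text \<open>The quadratic form \<open>r\<^sup>2 \<parallel>k\<parallel>\<^sup>2 - \<parallel>R k\<parallel>\<^sup>2\<close> is nonnegative on \<open>M\<close> and vanishes at \<open>y\<close>, so its polar
  form vanishes at \<open>(y, k)\<close>: otherwise the form would be negative at \<open>y + e k\<close> for a small \<open>e\<close> of
  the right sign.\<close>

lemma norm_maximizer_first_order:
  fixes R :: "'a::real_inner \<Rightarrow> 'b::real_inner"
  assumes R: "bounded_linear R" and M: "subspace M" and yk: "y \<in> M" "k \<in> M"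
    and le: "\<And>k. k \<in> M \<Longrightarrow> norm (R k) \<le> r * norm k" and eq: "norm (R y) = r * norm y"
  shows "inner (R y) (R k) = r\<^sup>2 * inner y k"
proof (rule ccontr)
  interpret R: bounded_linear R by (rule R)
  define b q e where "b = r\<^sup>2 * inner y k - inner (R y) (R k)"
    and "q = r\<^sup>2 * (norm k)\<^sup>2 - (norm (R k))\<^sup>2" and "e = - b / (q + 1)"
  have sq: "(norm (R x))\<^sup>2 \<le> r\<^sup>2 * (norm x)\<^sup>2" if "x \<in> M" for x
    using power_mono[OF le[OF that] norm_ge_zero, of 2] by (simp add: power_mult_distrib)
  have q: "q \<ge> 0" using sq[OF yk(2)] by (simp add: q_def)
  assume "inner (R y) (R k) \<noteq> r\<^sup>2 * inner y k"
  then have "b \<noteq> 0" by (simp add: b_def)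
  have "y + e *\<^sub>R k \<in> M" using M yk by (simp add: subspace_add subspace_scale)
  from sq[OF this] have "0 \<le> r\<^sup>2 * (norm (y + e *\<^sub>R k))\<^sup>2 - (norm (R y + e *\<^sub>R R k))\<^sup>2"
    by (simp add: R.add R.scaleR)
  also have "\<dots> = (r\<^sup>2 * (norm y)\<^sup>2 - (norm (R y))\<^sup>2) + 2 * e * b + e\<^sup>2 * q"
    unfolding b_def q_def power2_norm_eq_inner
    by (simp add: inner_add inner_commute algebra_simps power2_eq_square)
  also have "\<dots> = 2 * e * b + e\<^sup>2 * q" by (simp add: eq power_mult_distrib)
  also have "\<dots> = - (e\<^sup>2 * (q + 2))"
  proof -
    have b: "b = - (e * (q + 1))" using q by (simp add: e_def)
    show ?thesis by (subst b) (simp add: algebra_simps power2_eq_square)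
  qed
  also have "\<dots> < 0" using q \<open>b \<noteq> 0\<close> by (simp add: e_def zero_less_mult_iff)
  finally show False by simp
qed

definition orthogonal_to :: "'a::complex_inner set \<Rightarrow> 'a set" where
  "orthogonal_to B = {x. \<forall>b\<in>B. cinner b x = 0}"

lemma closed_orthogonal_to: "closed (orthogonal_to B)"
proof -
  have "orthogonal_to B = (\<Inter>b\<in>B. {x. cinner b x = 0})" by (auto simp: orthogonal_to_def)
  then show ?thesis
    by (auto intro!: closed_INT closed_Collect_eq
        bounded_linear.continuous_on[OF cinner.bounded_linear_right continuous_on_id])
qed

lemma orthogonal_to_closed_under:
  shows "x \<in> orthogonal_to B \<Longrightarrow> y \<in> orthogonal_to B \<Longrightarrow> x + y \<in> orthogonal_to B"
    and "x \<in> orthogonal_to B \<Longrightarrow> y \<in> orthogonal_to B \<Longrightarrow> x - y \<in> orthogonal_to B"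
    and "x \<in> orthogonal_to B \<Longrightarrow> c *\<^sub>C x \<in> orthogonal_to B"
  by (auto simp: orthogonal_to_def cinner.add_right cinner.diff_right cinner_scaleC_right)

lemma subspace_orthogonal_to: "subspace (orthogonal_to B)"
  by (auto simp: subspace_def orthogonal_to_def cinner.add_right scaleR_scaleC
      cinner_scaleC_right cinner.zero_right)

text \<open>Let \<open>R = (D - z)\<^sup>-\<^sup>1\<close>, let \<open>y\<close> maximize \<open>\<parallel>R y\<parallel>\<close> among the unit vectors orthogonal to \<open>B\<close>, and put
  \<open>w = R y\<close>, \<open>r = \<parallel>w\<parallel>\<close>. The first-order condition \<open>\<langle>w, R k\<rangle> = r\<^sup>2 \<langle>y, k\<rangle>\<close>, read for
  \<open>k = (D - z) h\<close>, places \<open>y\<close> in the domain of the adjoint of \<open>D\<close>, which is \<open>D\<close>. Together with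
  \<open>(D - z) w = y\<close> this says that \<open>A\<^sup>2 w = q w\<close> for \<open>A = D - Re z\<close> and a real number \<open>q\<close>, and
  \<open>q \<parallel>w\<parallel>\<^sup>2 = \<parallel>A w\<parallel>\<^sup>2\<close> makes \<open>q\<close> nonnegative. For \<open>c = sqrt q\<close> the product \<open>(A - c) (A + c)\<close>
  annihilates \<open>w\<close>, so either \<open>w\<close> or \<open>(A + c) w\<close> is an eigenvector of \<open>A\<close>. The argument works alike
  for real and for nonreal \<open>z\<close>, and the adjoint of \<open>R\<close> never occurs.\<close>

lemma eigenvector_in_orthogonal_complement:
  fixes D :: "'a::chilbert_space \<rightharpoonup> 'a"
  assumes sa: "self_adjoint D" and cr: "compact_resolvent D"
    and B: "orthonormal B" and eig: "\<And>b. b \<in> B \<Longrightarrow> \<exists>m::real. D b = Some (complex_of_real m *\<^sub>C b)"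
    and x0: "x0 \<in> orthogonal_to B" "x0 \<noteq> 0"
  obtains u and m :: real where "u \<in> orthogonal_to B" "u \<noteq> 0" "D u = Some (complex_of_real m *\<^sub>C u)"
proof -
  let ?M = "orthogonal_to B"
  have lin: "op_linear D" using sa by (simp add: self_adjoint_def)
  note lin_simps = op_linear_simps[OF lin]
  note sym = self_adjoint_symmetric[OF sa]
  obtain z R where R: "bounded_clinear R" and R1: "\<And>y. R y \<in> dom D"
    and R2: "\<And>y. the (D (R y)) - z *\<^sub>C R y = y"
    and R3: "\<And>x. x \<in> dom D \<Longrightarrow> R (the (D x) - z *\<^sub>C x) = x" and cpt: "compact (closure (R ` cball 0 1))"
    using cr unfolding compact_resolvent_def is_resolvent_at_def compact_operator_def by blast
  have R': "bounded_linear R" "\<And>c x. R (c *\<^sub>C x) = c *\<^sub>C R x"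
    using R by (auto simp: bounded_clinear_iff)
  interpret R: bounded_linear R by (rule R'(1))
  have R_eq_0: "y = 0" if "R y = 0" for y
    using R2[of y] that lin_simps(2) by (simp add: scaleC.zero_right)
  have Rb: "\<exists>c. c *\<^sub>C R b = b \<and> c \<noteq> 0" if b: "b \<in> B" for b
  proof -
    obtain m :: real where m: "D b = Some (complex_of_real m *\<^sub>C b)" using eig[OF b] by blast
    then have "R (complex_of_real m *\<^sub>C b - z *\<^sub>C b) = b" using R3[of b] by auto
    then have *: "(complex_of_real m - z) *\<^sub>C R b = b"
      by (simp add: R'(2)[symmetric] scaleC.diff_left)
    moreover have "b \<noteq> 0" using orthonormal_norm[OF B b] by auto
    ultimately show ?thesis by (metis scaleC.zero_left)
  qed
  have RM: "R y \<in> ?M" if "y \<in> ?M" for y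
    unfolding orthogonal_to_def
  proof safe
    fix b assume b: "b \<in> B"
    obtain m :: real where m: "D b = Some (complex_of_real m *\<^sub>C b)" using eig[OF b] by blast
    obtain c where c: "c *\<^sub>C R b = b" "c \<noteq> 0" using Rb[OF b] by blast
    have "c = complex_of_real m - z"
    proof -
      have "(complex_of_real m - z) *\<^sub>C R b = b"
        using R3[of b] m by (auto simp: R'(2)[symmetric] scaleC.diff_left)
      then have "(complex_of_real m - z - c) *\<^sub>C R b = 0" by (simp add: c(1) scaleC.diff_left)
      moreover have "R b \<noteq> 0" using c orthonormal_norm[OF B b] by (auto simp: scaleC.zero_right)
      ultimately show ?thesis by (metis eq_iff_diff_eq_0 mult_eq_0_iff norm_eq_zero norm_scaleC)
    qed
    have "0 = cinner b (the (D (R y)) - z *\<^sub>C R y)" using that b by (simp add: R2 orthogonal_to_def)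
    also have "\<dots> = cinner (the (D b)) (R y) - z * cinner b (R y)"
      using sym[OF R1, of b y] m by (auto simp: cinner.diff_right cinner_scaleC_right)
    also have "\<dots> = c * cinner b (R y)"
      by (simp add: m cinner_scaleC_left \<open>c = _\<close> algebra_simps)
    finally show "cinner b (R y) = 0" using c(2) by simp
  qed
  obtain y where y: "y \<in> ?M" "norm y = 1" "R y \<noteq> 0"
    and max: "\<And>k. k \<in> ?M \<Longrightarrow> norm (R k) \<le> norm (R y) * norm k"
    using compact_norm_attained[OF R'(1) cpt closed_orthogonal_to subspace_orthogonal_to x0(1)] R_eq_0 x0(2)
    by blast
  define w r where "w = R y" and "r = norm w"
  have r: "r > 0" using y(3) by (simp add: r_def w_def)
  have Re_eq: "Re (cinner w (R k)) = r\<^sup>2 * Re (cinner y k)" if "k \<in> ?M" for k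
    using norm_maximizer_first_order[OF R'(1) subspace_orthogonal_to y(1) that max] y(2)
    by (simp add: w_def r_def inner_eq_Re_cinner)
  \<comment> \<open>The imaginary part of the identity is the real part for \<open>\<i> k\<close>.\<close>
  have onM: "cinner w (R k) = r\<^sup>2 * cinner y k" if "k \<in> ?M" for k
    using Re_eq[OF that] Re_eq[OF orthogonal_to_closed_under(3)[OF that, of \<i>]]
    by (simp add: R'(2) cinner_scaleC_right complex_eq_iff)
  \<comment> \<open>On the closed span of \<open>B\<close>, which \<open>R\<close> preserves, both sides vanish.\<close>
  have all: "cinner w (R k) = r\<^sup>2 * cinner y k" for k
  proof -
    obtain s where s: "((\<lambda>b. cinner b k *\<^sub>C b) has_sum s) B" "\<And>b. b \<in> B \<Longrightarrow> cinner b (k - s) = 0"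
      using Bessel_sum_exists[OF B] by metis
    have z0: "(f has_sum t) B \<Longrightarrow> (\<And>b. b \<in> B \<Longrightarrow> f b = 0) \<Longrightarrow> t = 0" for f :: "'a \<Rightarrow> complex" and t
      using has_sum_0 has_sum_unique by blast
    have "cinner y s = 0"
    proof (rule z0[OF has_sum_bounded_linear[OF cinner.bounded_linear_right s(1)]])
      fix b assume "b \<in> B"
      then have "cinner b y = 0" using y(1) by (simp add: orthogonal_to_def)
      then show "cinner y (cinner b k *\<^sub>C b) = 0"
        by (metis cinner_scaleC_right cinner_commute complex_cnj_zero mult_zero_right)
    qed
    moreover have "cinner w (R s) = 0"
    proof (rule z0[OF has_sum_bounded_linear[OF bounded_linear_compose[OF cinner.bounded_linear_right R'(1)] s(1)]])
      fix b assume b: "b \<in> B"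
      then have "cinner b w = 0" using RM[OF y(1)] by (simp add: orthogonal_to_def w_def)
      then have "cinner w b = 0" by (metis cinner_commute complex_cnj_zero)
      moreover obtain c where "c *\<^sub>C R b = b" "c \<noteq> 0" using Rb[OF b] by blast
      ultimately have "cinner w (R b) = 0" by (metis cinner_scaleC_right mult_eq_0_iff)
      then show "cinner w (R (cinner b k *\<^sub>C b)) = 0" by (simp add: R'(2) cinner_scaleC_right)
    qed
    moreover have "k - s \<in> ?M" using s(2) by (simp add: orthogonal_to_def)
    ultimately show ?thesis using onM[of "k - s"] by (simp add: R.diff cinner.diff_right)
  qed
  have wD: "w \<in> dom D" "the (D w) = y + z *\<^sub>C w" using R1[of y] R2[of y] by (auto simp: w_def algebra_simps)
  define \<kappa> where "\<kappa> = 1 / r\<^sup>2"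
  \<comment> \<open>The first-order condition for \<open>k = (D - z) h\<close> exhibits the value of the adjoint at \<open>y\<close>.\<close>
  have "D y = Some (cnj z *\<^sub>C y + complex_of_real \<kappa> *\<^sub>C w)"
    unfolding self_adjoint_iff_Some[OF sa]
  proof
    fix h assume h: "h \<in> dom D"
    have "cinner w h = r\<^sup>2 * (cinner y (the (D h)) - z * cinner y h)"
      using all[of "the (D h) - z *\<^sub>C h"] R3[OF h] by (simp add: cinner.diff_right cinner_scaleC_right)
    then show "cinner y (the (D h)) = cinner (cnj z *\<^sub>C y + complex_of_real \<kappa> *\<^sub>C w) h"
      using r by (simp add: cinner.add_left cinner_scaleC_left \<kappa>_def field_simps)
  qed
  then have yD: "y \<in> dom D" "the (D y) = cnj z *\<^sub>C y + complex_of_real \<kappa> *\<^sub>C w" by auto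
  define a where "a = Re z"
  define v where "v = the (D w) - complex_of_real a *\<^sub>C w"
  define q where "q = \<kappa> - (Im z)\<^sup>2"
  have v: "v = y + (z - complex_of_real a) *\<^sub>C w" by (simp add: v_def wD scaleC.diff_left)
  have vD: "v \<in> dom D" unfolding v by (intro lin_simps yD wD)
  have iz: "(z - complex_of_real a) = \<i> * Im z" "(cnj z - complex_of_real a) = - \<i> * Im z"
    by (auto simp: a_def complex_eq_iff)
  have Av: "the (D v) - complex_of_real a *\<^sub>C v = complex_of_real q *\<^sub>C w"
  proof -
    have double: "(d * 2) *\<^sub>C x = d *\<^sub>C x + d *\<^sub>C x" for d and x :: 'a
      by (simp only: mult_2_right scaleC_add_left)
    have double': "(d * (d' * 2)) *\<^sub>C x = (d * d') *\<^sub>C x + (d * d') *\<^sub>C x" for d d' and x :: 'a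
      by (simp only: mult_2_right scaleC_add_left distrib_left)
    have "the (D v) - complex_of_real a *\<^sub>C v
      = (cnj z - complex_of_real a + (z - complex_of_real a)) *\<^sub>C y
        + (complex_of_real \<kappa> + (z - complex_of_real a) * (z - complex_of_real a)) *\<^sub>C w"
      unfolding v using yD wD
      by (simp add: lin_simps scaleC.diff_left scaleC.add_left scaleC_add_right scaleC_scaleC
          scaleC.diff_right double double' algebra_simps)
    then show ?thesis
      by (simp add: iz q_def scaleC.zero_left power2_eq_square algebra_simps)
  qed
  have "complex_of_real q * complex_of_real ((norm w)\<^sup>2) = complex_of_real ((norm v)\<^sup>2)"
  proof -
    have "complex_of_real q * complex_of_real ((norm w)\<^sup>2) = cinner w (the (D v) - complex_of_real a *\<^sub>C v)"
      by (simp only: Av cinner_scaleC_right cinner_self)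
    also have "\<dots> = cinner v v"
      using sym[OF vD wD(1)] sym[OF wD(1) wD(1)]
      by (simp add: v_def cinner.diff_right cinner.diff_left cinner_scaleC_left cinner_scaleC_right)
    finally show ?thesis by (simp only: cinner_self)
  qed
  then have "q * (norm w)\<^sup>2 = (norm v)\<^sup>2" unfolding of_real_mult[symmetric] of_real_eq_iff .
  then have q: "q \<ge> 0" using r by (smt (verit) r_def zero_le_mult_iff zero_le_power2 zero_less_power)
  define c where "c = sqrt q"
  have cq: "complex_of_real q = complex_of_real c * complex_of_real c"
    using q by (simp add: c_def flip: of_real_mult)
  have wM: "w \<in> ?M" using RM[OF y(1)] by (simp add: w_def)
  have vM: "v \<in> ?M" unfolding v by (intro orthogonal_to_closed_under y(1) wM)
  define u where "u = v + complex_of_real c *\<^sub>C w"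
  show ?thesis
  proof (cases "u = 0")
    case True
    then have "the (D w) = complex_of_real (a - c) *\<^sub>C w"
      by (simp add: u_def v_def scaleC.diff_left add_eq_0_iff algebra_simps)
    then have "D w = Some (complex_of_real (a - c) *\<^sub>C w)" using wD(1) by auto
    then show ?thesis using that[of w "a - c"] wM r by (auto simp: r_def)
  next
    case False
    have uD: "u \<in> dom D" unfolding u_def by (intro lin_simps vD wD)
    have "the (D u) = the (D v) + complex_of_real c *\<^sub>C the (D w)"
      unfolding u_def by (simp add: lin_simps vD wD(1))
    also have "the (D v) = complex_of_real a *\<^sub>C v + complex_of_real q *\<^sub>C w"
      using Av by (simp add: algebra_simps)
    also have "the (D w) = complex_of_real a *\<^sub>C w + v" by (simp add: v_def)
    finally have "the (D u) = complex_of_real (a + c) *\<^sub>C u"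
      by (simp add: u_def cq scaleC_add_right scaleC.add_left scaleC_scaleC distrib_left mult.commute)
    then have "D u = Some (complex_of_real (a + c) *\<^sub>C u)" using uD by auto
    moreover have "u \<in> ?M" unfolding u_def by (intro orthogonal_to_closed_under vM wM)
    ultimately show ?thesis using that False by blast
  qed
qed

text \<open>Zorn's lemma yields a maximal orthonormal set of eigenvectors. A nonzero vector orthogonal to it
  would produce a further eigenvector.\<close>

theorem eigenbasis_exists:
  fixes D :: "'a::chilbert_space \<rightharpoonup> 'a"
  assumes sa: "self_adjoint D" and cr: "compact_resolvent D"
  obtains B and \<mu> :: "'a \<Rightarrow> real"
  where "orthonormal_basis B" "\<And>b. b \<in> B \<Longrightarrow> D b = Some (complex_of_real (\<mu> b) *\<^sub>C b)"
proof -
  define A where "A = {B. orthonormal B \<and> (\<forall>b\<in>B. \<exists>m::real. D b = Some (complex_of_real m *\<^sub>C b))}"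
  have "\<forall>C\<in>chains A. \<Union>C \<in> A"
  proof
    fix C assume C: "C \<in> chains A"
    have "cinner x y = (if x = y then 1 else 0)" if "x \<in> X" "X \<in> C" "y \<in> Y" "Y \<in> C" for x y X Y
    proof -
      have "X \<subseteq> Y \<or> Y \<subseteq> X" using C that unfolding chains_def chain_subset_def by blast
      moreover have "orthonormal X" "orthonormal Y" using C that unfolding chains_def A_def by auto
      ultimately show ?thesis using that unfolding orthonormal_def by blast
    qed
    then show "\<Union>C \<in> A" using C unfolding A_def chains_def orthonormal_def by auto
  qed
  then obtain B where B: "B \<in> A" and max: "\<And>X. X \<in> A \<Longrightarrow> B \<subseteq> X \<Longrightarrow> X = B"
    using Zorn_Lemma[of A] by blast
  have on: "orthonormal B" and eig: "\<And>b. b \<in> B \<Longrightarrow> \<exists>m::real. D b = Some (complex_of_real m *\<^sub>C b)"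
    using B by (auto simp: A_def)
  have lin: "op_linear D" using sa by (simp add: self_adjoint_def)
  have "orthonormal_basis B"
  proof (rule orthonormal_basisI[OF on], rule ccontr)
    fix x assume "\<And>b. b \<in> B \<Longrightarrow> cinner b x = 0" "x \<noteq> 0"
    then obtain u and m :: real where u: "u \<in> orthogonal_to B" "u \<noteq> 0" "D u = Some (complex_of_real m *\<^sub>C u)"
      using eigenvector_in_orthogonal_complement[OF sa cr on eig, of x]
      unfolding orthogonal_to_def by blast
    define e where "e = complex_of_real (1 / norm u) *\<^sub>C u"
    have e1: "cinner e e = 1" using u(2) by (simp add: e_def cinner_self norm_scaleC norm_divide)
    have eB: "cinner b e = 0" "cinner e b = 0" if "b \<in> B" for b
      using u(1) that by (auto simp: e_def orthogonal_to_def cinner_scaleC_right cinner_scaleC_left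
          cinner_commute[of u b])
    have eD: "D e = Some (complex_of_real m *\<^sub>C e)"
    proof -
      have "u \<in> dom D" using u(3) by auto
      then have "e \<in> dom D" "the (D e) = complex_of_real m *\<^sub>C e"
        unfolding e_def using u(3) by (auto simp: op_linear_simps[OF lin] scaleC_scaleC mult.commute simp del: domIff)
      then show ?thesis by auto
    qed
    have "insert e B \<in> A"
      using on eig eD e1 eB unfolding A_def orthonormal_def by auto
    then have "e \<in> B" using max by blast
    then show False using eB(1) e1 by force
  qed
  moreover obtain \<mu> where "\<And>b. b \<in> B \<Longrightarrow> D b = Some (complex_of_real (\<mu> b) *\<^sub>C b)" using eig by metis
  ultimately show ?thesis using that by blast
qed

section \<open>Diagonal operators and their spectral measures\<close>

lemma orthonormal_basis_orthonormal: "orthonormal_basis B \<Longrightarrow> orthonormal B"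
  by (simp add: orthonormal_basis_iff)

lemma orthonormal_basis_eqI:
  assumes "orthonormal_basis B" "\<And>b. b \<in> B \<Longrightarrow> cinner b x = cinner b y"
  shows "x = y"
  using orthonormal_basis_total[OF assms(1), of "x - y"] assms(2) by (simp add: cinner.diff_right)

text \<open>Multiplication by \<open>g\<close> in the coordinates of the orthonormal basis \<open>B\<close>, on its maximal domain.\<close>

definition diag_op :: "'a::complex_inner set \<Rightarrow> ('a \<Rightarrow> real) \<Rightarrow> ('a \<rightharpoonup> 'a)" where
  "diag_op B g = (\<lambda>x. if (\<lambda>b. (g b)\<^sup>2 * (cmod (cinner b x))\<^sup>2) summable_on B
     then Some (\<Sum>\<^sub>\<infinity>b\<in>B. (complex_of_real (g b) * cinner b x) *\<^sub>C b) else None)"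

lemma dom_diag_op: "dom (diag_op B g) = {x. (\<lambda>b. (g b)\<^sup>2 * (cmod (cinner b x))\<^sup>2) summable_on B}"
  by (auto simp: diag_op_def dom_def)

text \<open>The obvious spectral measure of \<^term>\<open>diag_op B \<mu>\<close>; the case distinction only serves the
  convention for sets that are not Borel.\<close>

definition diag_pvm :: "'a::complex_inner set \<Rightarrow> ('a \<Rightarrow> real) \<Rightarrow> real set \<Rightarrow> 'a \<Rightarrow> 'a" where
  "diag_pvm B \<mu> S = (if S \<in> sets borel then (\<lambda>x. the (diag_op B (\<lambda>b. indicator S (\<mu> b)) x)) else (\<lambda>_. 0))"

context
  fixes B :: "'a::chilbert_space set"
  assumes B: "orthonormal_basis B"
begin

lemma diag_op_has_sum:
  assumes "x \<in> dom (diag_op B g)"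
  shows "((\<lambda>b. (complex_of_real (g b) * cinner b x) *\<^sub>C b) has_sum the (diag_op B g x)) B"
proof -
  have s: "(\<lambda>b. (g b)\<^sup>2 * (cmod (cinner b x))\<^sup>2) summable_on B" using assms by (simp add: dom_diag_op)
  then have "(\<lambda>b. (cmod (complex_of_real (g b) * cinner b x))\<^sup>2) summable_on B"
    by (simp add: norm_mult power_mult_distrib)
  from summable_orthonormal[OF orthonormal_basis_orthonormal[OF B] this] s
  show ?thesis by (simp add: diag_op_def)
qed

lemma cinner_diag_op:
  assumes "x \<in> dom (diag_op B g)" "b \<in> B"
  shows "cinner b (the (diag_op B g x)) = complex_of_real (g b) * cinner b x"
  by (rule orthonormal_coefficient[OF orthonormal_basis_orthonormal[OF B] diag_op_has_sum[OF assms(1)] assms(2)])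

text \<open>Coordinates decide membership in the domain as well: if some \<open>y\<close> has the coordinates that the
  value ought to have, they are square summable by Bessel's inequality.\<close>

lemma diag_op_eq_Some_iff:
  "diag_op B g x = Some y \<longleftrightarrow> (\<forall>b\<in>B. cinner b y = complex_of_real (g b) * cinner b x)" (is "?l = ?r")
proof
  assume l: ?l
  then have "x \<in> dom (diag_op B g)" by auto
  from cinner_diag_op[OF this] l show ?r by simp
next
  assume r: ?r
  have "(\<lambda>b. (cmod (cinner b y))\<^sup>2) summable_on B"
    by (rule Bessel_summable[OF orthonormal_basis_orthonormal[OF B]])
  also have "?this \<longleftrightarrow> (\<lambda>b. (g b)\<^sup>2 * (cmod (cinner b x))\<^sup>2) summable_on B"
    by (rule summable_on_cong) (use r in \<open>auto simp: norm_mult power_mult_distrib\<close>)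
  finally have d: "x \<in> dom (diag_op B g)" by (simp add: dom_diag_op)
  have "the (diag_op B g x) = y"
    by (rule orthonormal_basis_eqI[OF B]) (simp add: r cinner_diag_op[OF d])
  then show ?l using d by auto
qed

lemma diag_op_basis: "b \<in> B \<Longrightarrow> diag_op B g b = Some (complex_of_real (g b) *\<^sub>C b)"
  using orthonormal_basis_orthonormal[OF B]
  by (auto simp: diag_op_eq_Some_iff cinner_scaleC_right orthonormal_def)

lemma op_linear_diag_op: "op_linear (diag_op B g)"
proof -
  have eq: "x \<in> dom (diag_op B g) \<Longrightarrow> diag_op B g x = Some (the (diag_op B g x))" for x by auto
  have add: "diag_op B g (x + y) = Some (the (diag_op B g x) + the (diag_op B g y))"
    if "x \<in> dom (diag_op B g)" "y \<in> dom (diag_op B g)" for x y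
    unfolding diag_op_eq_Some_iff using that by (simp add: cinner.add_right cinner_diag_op algebra_simps)
  have scale: "diag_op B g (c *\<^sub>C x) = Some (c *\<^sub>C the (diag_op B g x))"
    if "x \<in> dom (diag_op B g)" for x c
    unfolding diag_op_eq_Some_iff using that by (simp add: cinner_scaleC_right cinner_diag_op algebra_simps)
  have zero: "diag_op B g 0 = Some 0" by (simp add: diag_op_eq_Some_iff cinner.zero_right)
  show ?thesis
    unfolding op_linear_def complex_vector.subspace_def
  proof (intro conjI ballI allI)
    show "0 \<in> dom (diag_op B g)" by (rule domI, rule zero)
    fix x c assume x: "x \<in> dom (diag_op B g)"
    show "c *\<^sub>C x \<in> dom (diag_op B g)" by (rule domI, rule scale[OF x])
    show "the (diag_op B g (c *\<^sub>C x)) = c *\<^sub>C the (diag_op B g x)" by (simp add: scale[OF x])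
    fix y assume y: "y \<in> dom (diag_op B g)"
    show "x + y \<in> dom (diag_op B g)" by (rule domI, rule add[OF x y])
    show "the (diag_op B g (x + y)) = the (diag_op B g x) + the (diag_op B g y)" by (simp add: add[OF x y])
  qed
qed

lemma dense_dom_diag_op: "closure (dom (diag_op B g)) = UNIV"
proof -
  have "cspan B \<subseteq> dom (diag_op B g)"
    using op_linear_diag_op[of g] unfolding op_linear_def
    by (intro complex_vector.span_minimal) (auto simp: diag_op_basis)
  then show ?thesis using B closure_mono unfolding orthonormal_basis_iff by blast
qed

lemma diag_op_symmetric:
  assumes "x \<in> dom (diag_op B g)" "y \<in> dom (diag_op B g)"
  shows "cinner y (the (diag_op B g x)) = cinner (the (diag_op B g y)) x"
proof -
  have "cinner y b * cinner b (the (diag_op B g x)) = cinner (the (diag_op B g y)) b * cinner b x"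
    if "b \<in> B" for b
    using cinner_diag_op[OF assms(1) that] cinner_diag_op[OF assms(2) that]
    by (subst (1 2) cinner_commute[of _ b]) simp
  then have "((\<lambda>b. cinner y b * cinner b (the (diag_op B g x))) has_sum cinner (the (diag_op B g y)) x) B"
    using Parseval[OF B, of "the (diag_op B g y)" x] by (subst has_sum_cong) auto
  then show ?thesis using Parseval[OF B, of y "the (diag_op B g x)"] has_sum_unique by blast
qed

text \<open>The operator \<open>D\<close> is contained in the symmetric operator \<^term>\<open>diag_op B \<mu>\<close>, and a self-adjoint
  operator has no proper symmetric extension.\<close>

lemma self_adjoint_eq_diag_op:
  assumes sa: "self_adjoint D" and eig: "\<And>b. b \<in> B \<Longrightarrow> D b = Some (complex_of_real (\<mu> b) *\<^sub>C b)"
  shows "D = diag_op B \<mu>"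
proof -
  have coeff: "cinner b (the (D x)) = complex_of_real (\<mu> b) * cinner b x" if "b \<in> B" "x \<in> dom D" for b x
  proof -
    have "b \<in> dom D" using eig[OF that(1)] by auto
    then show ?thesis
      using self_adjoint_symmetric[OF sa that(2), of b] eig[OF that(1)] by (simp add: cinner_scaleC_left)
  qed
  have "D x = Some y \<longleftrightarrow> diag_op B \<mu> x = Some y" for x y
  proof
    assume "D x = Some y"
    then show "diag_op B \<mu> x = Some y" using coeff[of _ x] by (auto simp: diag_op_eq_Some_iff)
  next
    assume y: "diag_op B \<mu> x = Some y"
    show "D x = Some y" unfolding self_adjoint_iff_Some[OF sa]
    proof
      fix h assume h: "h \<in> dom D"
      then have "diag_op B \<mu> h = Some (the (D h))" using coeff by (auto simp: diag_op_eq_Some_iff)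
      then show "cinner x (the (D h)) = cinner y h" using diag_op_symmetric[of h \<mu> x] y by auto
    qed
  qed
  then show ?thesis by (intro ext option.expand) (metis not_None_eq option.sel)+
qed

lemma diag_op_bounded:
  assumes g: "\<And>b. b \<in> B \<Longrightarrow> \<bar>g b\<bar> \<le> C"
  shows "dom (diag_op B g) = UNIV" and "bounded_clinear (\<lambda>x. the (diag_op B g x))"
proof -
  have C: "(g b)\<^sup>2 * (cmod (cinner b x))\<^sup>2 \<le> C\<^sup>2 * (cmod (cinner b x))\<^sup>2" if "b \<in> B" for b x
    using power_mono[OF g[OF that], of 2] by (intro mult_right_mono) auto
  have sC: "((\<lambda>b. C\<^sup>2 * (cmod (cinner b x))\<^sup>2) has_sum C\<^sup>2 * (norm x)\<^sup>2) B" for x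
    by (rule has_sum_cmult_right[OF Parseval_norm[OF B]])
  have "(\<lambda>b. (g b)\<^sup>2 * (cmod (cinner b x))\<^sup>2) summable_on B" for x
    by (rule summable_on_comparison_test[OF has_sum_imp_summable[OF sC]]) (use C in auto)
  then show dom: "dom (diag_op B g) = UNIV" by (simp add: dom_diag_op)
  have "norm (the (diag_op B g x)) \<le> norm x * \<bar>C\<bar>" for x
  proof -
    have "((\<lambda>b. (g b)\<^sup>2 * (cmod (cinner b x))\<^sup>2) has_sum (norm (the (diag_op B g x)))\<^sup>2) B"
      using Parseval_norm[OF B, of "the (diag_op B g x)"]
      by (subst has_sum_cong) (auto simp: cinner_diag_op dom norm_mult power_mult_distrib)
    then have "(norm (the (diag_op B g x)))\<^sup>2 \<le> C\<^sup>2 * (norm x)\<^sup>2"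
      by (rule has_sum_mono[OF _ sC]) (use C in auto)
    then have "(norm (the (diag_op B g x)))\<^sup>2 \<le> (norm x * \<bar>C\<bar>)\<^sup>2"
      by (simp add: power_mult_distrib mult.commute)
    then show ?thesis by (rule power2_le_imp_le) simp
  qed
  then show "bounded_clinear (\<lambda>x. the (diag_op B g x))"
    unfolding bounded_clinear_iff
    by (auto intro!: bounded_linear_intro[where K="\<bar>C\<bar>"] simp: op_linear_simps[OF op_linear_diag_op] dom scaleR_scaleC)
qed

lemma cinner_diag_pvm:
  assumes "b \<in> B" "S \<in> sets borel"
  shows "cinner b (diag_pvm B \<mu> S x) = (if \<mu> b \<in> S then cinner b x else 0)"
  using cinner_diag_op[of x "\<lambda>b. indicator S (\<mu> b)" b] assms diag_op_bounded(1)[of "\<lambda>b. indicator S (\<mu> b)" 1]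
  by (auto simp: diag_pvm_def indicator_def)

lemma diag_pvm_has_sum:
  assumes "S \<in> sets borel"
  shows "((\<lambda>b. cinner b x *\<^sub>C b) has_sum diag_pvm B \<mu> S x) {b\<in>B. \<mu> b \<in> S}"
proof -
  have "((\<lambda>b. cinner b (diag_pvm B \<mu> S x) *\<^sub>C b) has_sum diag_pvm B \<mu> S x) B"
    by (rule orthonormal_basis_expansion[OF B])
  then show ?thesis
    by (rule has_sum_cong_neutral[THEN iffD1, rotated -1]) (auto simp: cinner_diag_pvm assms scaleC.zero_left)
qed

text \<open>All properties except countable additivity are visible in coordinates.\<close>

lemma projection_valued_measure_diag_pvm: "projection_valued_measure (diag_pvm B \<mu>)"
  unfolding projection_valued_measure_def
proof (intro conjI ballI allI impI)
  fix S :: "real set" and x y assume S: "S \<in> sets borel"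
  show "bounded_clinear (diag_pvm B \<mu> S)"
    using S diag_op_bounded(2)[of "\<lambda>b. indicator S (\<mu> b)" 1] by (simp add: diag_pvm_def)
  show "diag_pvm B \<mu> S (diag_pvm B \<mu> S x) = diag_pvm B \<mu> S x"
    by (rule orthonormal_basis_eqI[OF B]) (simp add: cinner_diag_pvm S)
  show "cinner (diag_pvm B \<mu> S x) y = cinner x (diag_pvm B \<mu> S y)"
    using diag_op_symmetric[of y "\<lambda>b. indicator S (\<mu> b)" x] S diag_op_bounded(1)[of "\<lambda>b. indicator S (\<mu> b)" 1]
    by (auto simp: diag_pvm_def)
next
  show "diag_pvm B \<mu> UNIV = id"
    by (rule ext, rule orthonormal_basis_eqI[OF B]) (simp add: cinner_diag_pvm)
next
  fix S T :: "real set" assume "S \<in> sets borel" "T \<in> sets borel"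
  then show "diag_pvm B \<mu> (S \<inter> T) = diag_pvm B \<mu> S \<circ> diag_pvm B \<mu> T"
    by (intro ext orthonormal_basis_eqI[OF B]) (simp add: cinner_diag_pvm)
next
  fix A :: "nat \<Rightarrow> real set" and x assume A: "range A \<subseteq> sets borel" "disjoint_family A"
  \<comment> \<open>Countable additivity regroups an unconditionally convergent expansion along the disjoint sets
    \<open>A n\<close>.\<close>
  let ?S = "Sigma UNIV (\<lambda>n. {b\<in>B. \<mu> b \<in> A n})"
  have An: "A n \<in> sets borel" for n using A(1) by auto
  have U: "(\<Union>n. A n) \<in> sets borel" using An by blast
  have inj: "inj_on snd ?S"
    using A(2) by (auto simp: inj_on_def disjoint_family_on_def)
  have im: "snd ` ?S = {b\<in>B. \<mu> b \<in> (\<Union>n. A n)}" by force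
  have "((\<lambda>b. cinner b x *\<^sub>C b) has_sum diag_pvm B \<mu> (\<Union>n. A n) x) (snd ` ?S)"
    unfolding im by (rule diag_pvm_has_sum[OF U])
  then have "(((\<lambda>b. cinner b x *\<^sub>C b) \<circ> snd) has_sum diag_pvm B \<mu> (\<Union>n. A n) x) ?S"
    using has_sum_reindex[OF inj] by blast
  then have "((\<lambda>n. diag_pvm B \<mu> (A n) x) has_sum diag_pvm B \<mu> (\<Union>n. A n) x) UNIV"
    by (rule has_sum_SigmaD) (simp add: diag_pvm_has_sum[OF An])
  then show "(\<lambda>n. diag_pvm B \<mu> (A n) x) sums diag_pvm B \<mu> (\<Union>n. A n) x"
    by (rule has_sum_imp_sums)
qed (simp add: diag_pvm_def)

end

lemma sets_scalar_measure[simp, measurable_cong]: "sets (scalar_measure E x) = sets borel"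
  and space_scalar_measure[simp]: "space (scalar_measure E x) = UNIV"
proof -
  show "sets (scalar_measure E x) = sets borel"
    unfolding scalar_measure_def by (subst sets_measure_of) (use sets.sigma_sets_eq[of borel] in auto)
  show "space (scalar_measure E x) = UNIV"
    unfolding scalar_measure_def by (rule space_measure_of) auto
qed

lemma pvm_norm_square:
  assumes E: "projection_valued_measure E" and S: "S \<in> sets borel"
  shows "Re (cinner x (E S x)) = (norm (E S x))\<^sup>2"
proof -
  have "cinner x (E S x) = cinner (E S x) (E S x)"
    using E S unfolding projection_valued_measure_def by metis
  then show ?thesis by (simp add: cinner_self)
qed

lemma emeasure_scalar_measure:
  assumes E: "projection_valued_measure E" and S: "S \<in> sets borel"
  shows "emeasure (scalar_measure E x) S = ennreal ((norm (E S x))\<^sup>2)"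
proof -
  let ?m = "\<lambda>S. ennreal (Re (cinner x (E S x)))"
  have sums: "(\<lambda>n. Re (cinner x (E (A n) x))) sums Re (cinner x (E (\<Union>n. A n) x))"
    if "range A \<subseteq> sets borel" "disjoint_family A" for A :: "nat \<Rightarrow> real set"
  proof -
    have "(\<lambda>n. E (A n) x) sums E (\<Union>n. A n) x"
      using E that unfolding projection_valued_measure_def by blast
    then show ?thesis
      by (intro bounded_linear.sums[OF bounded_linear_compose[OF bounded_linear_Re cinner.bounded_linear_right]])
  qed
  have nonneg: "0 \<le> Re (cinner x (E S x))" if "S \<in> sets borel" for S
    by (simp add: pvm_norm_square[OF E that])
  have "emeasure (scalar_measure E x) S = ?m S"
  proof (rule emeasure_measure_of[OF scalar_measure_def])
    show "countably_additive (sets (scalar_measure E x)) ?m"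
      unfolding countably_additive_def
      by (auto intro!: suminf_ennreal_eq sums nonneg)
    show "positive (sets (scalar_measure E x)) ?m"
    proof -
      have "(\<lambda>n. Re (cinner x (E {} x))) sums Re (cinner x (E {} x))"
        using sums[of "\<lambda>_. {}"] by (auto simp: disjoint_family_on_def)
      then have "Re (cinner x (E {} x)) = 0" using sums_summable summable_const_iff by blast
      then show ?thesis by (simp add: positive_def)
    qed
  qed (use S in auto)
  then show ?thesis by (simp add: pvm_norm_square[OF E S])
qed

lemma integrable_count_space_iff:
  fixes f :: "'a \<Rightarrow> real"
  shows "integrable (count_space A) f \<longleftrightarrow> f summable_on A"
  using abs_summable_equivalent[of f A] summable_on_iff_abs_summable_on_real[of f A]
  by (simp add: Infinite_Set_Sum.abs_summable_on_def)

lemma integral_count_space: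
  fixes f :: "'a \<Rightarrow> real"
  assumes "f summable_on A"
  shows "integral\<^sup>L (count_space A) f = infsum f A"
  using infsetsum_infsum[of f A] assms integrable_count_space_iff[of A f]
  by (simp add: infsetsum_def Infinite_Set_Sum.abs_summable_on_def)

text \<open>The measure has an atom of mass \<open>\<bar>\<langle>b, x\<rangle>\<bar>\<^sup>2\<close> at \<open>\<mu> b\<close> for each \<open>b\<close>; written as a push-forward of
  a weighted counting measure, it turns integrals into sums over \<open>B\<close>.\<close>

lemma scalar_measure_diag_pvm:
  fixes B :: "'a::chilbert_space set"
  assumes B: "orthonormal_basis B"
  shows "scalar_measure (diag_pvm B \<mu>) x
    = distr (density (count_space B) (\<lambda>b. ennreal ((cmod (cinner b x))\<^sup>2))) borel \<mu>" (is "_ = distr ?N borel \<mu>")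
proof (rule measure_eqI)
  fix S assume "S \<in> sets (scalar_measure (diag_pvm B \<mu>) x)"
  then have S: "S \<in> sets borel" by simp
  have "((\<lambda>b. (cmod (cinner b (diag_pvm B \<mu> S x)))\<^sup>2) has_sum (norm (diag_pvm B \<mu> S x))\<^sup>2) B"
    by (rule Parseval_norm[OF B])
  also have "?this \<longleftrightarrow> ((\<lambda>b. (cmod (cinner b x))\<^sup>2 * indicator S (\<mu> b)) has_sum (norm (diag_pvm B \<mu> S x))\<^sup>2) B"
    by (rule has_sum_cong) (simp add: cinner_diag_pvm[OF B _ S])
  finally have *: "((\<lambda>b. (cmod (cinner b x))\<^sup>2 * indicator S (\<mu> b)) has_sum (norm (diag_pvm B \<mu> S x))\<^sup>2) B" .
  have "emeasure (distr ?N borel \<mu>) S = emeasure ?N (\<mu> -` S \<inter> B)"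
    using S by (subst emeasure_distr) auto
  also have "\<dots> = (\<integral>\<^sup>+b. ennreal ((cmod (cinner b x))\<^sup>2) * indicator (\<mu> -` S \<inter> B) b \<partial>count_space B)"
    by (rule emeasure_density) auto
  also have "\<dots> = (\<integral>\<^sup>+b. ennreal ((cmod (cinner b x))\<^sup>2 * indicator S (\<mu> b)) \<partial>count_space B)"
    by (rule nn_integral_cong) (auto simp: indicator_def)
  also have "\<dots> = ennreal (infsum (\<lambda>b. (cmod (cinner b x))\<^sup>2 * indicator S (\<mu> b)) B)"
    using has_sum_imp_summable[OF *]
    by (subst nn_integral_eq_integral) (auto simp: integrable_count_space_iff integral_count_space)
  also have "\<dots> = emeasure (scalar_measure (diag_pvm B \<mu>) x) S"
    using * by (simp add: emeasure_scalar_measure[OF projection_valued_measure_diag_pvm[OF B] S] infsumI)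
  finally show "emeasure (scalar_measure (diag_pvm B \<mu>) x) S = emeasure (distr ?N borel \<mu>) S" by simp
qed simp

lemma scalar_measure_diag_pvm_integral:
  fixes B :: "'a::chilbert_space set"
  assumes B: "orthonormal_basis B" and h[measurable]: "h \<in> borel_measurable borel"
  shows "integrable (scalar_measure (diag_pvm B \<mu>) x) h
      \<longleftrightarrow> (\<lambda>b. (cmod (cinner b x))\<^sup>2 * h (\<mu> b)) summable_on B"
    and "(\<lambda>b. (cmod (cinner b x))\<^sup>2 * h (\<mu> b)) summable_on B \<Longrightarrow>
      (\<integral>s. h s \<partial>scalar_measure (diag_pvm B \<mu>) x) = (\<Sum>\<^sub>\<infinity>b\<in>B. (cmod (cinner b x))\<^sup>2 * h (\<mu> b))"
  by (simp_all add: scalar_measure_diag_pvm[OF B] integrable_distr_eq integral_distr integrable_density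
      integral_density integrable_count_space_iff integral_count_space)

lemma is_spectral_integral_diag_op:
  fixes B :: "'a::chilbert_space set"
  assumes B: "orthonormal_basis B" and f[measurable]: "f \<in> borel_measurable borel"
  shows "is_spectral_integral (diag_pvm B \<mu>) f (diag_op B (\<lambda>b. f (\<mu> b)))"
  unfolding is_spectral_integral_def
proof (intro conjI ballI)
  show "op_linear (diag_op B (\<lambda>b. f (\<mu> b)))" by (rule op_linear_diag_op[OF B])
  show "dom (diag_op B (\<lambda>b. f (\<mu> b))) = {x. integrable (scalar_measure (diag_pvm B \<mu>) x) (\<lambda>s. (f s)\<^sup>2)}"
    by (simp add: scalar_measure_diag_pvm_integral[OF B] dom_diag_op mult.commute)
  fix x assume x: "x \<in> dom (diag_op B (\<lambda>b. f (\<mu> b)))"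
  let ?g = "\<lambda>b. (cmod (cinner b x))\<^sup>2 * f (\<mu> b)"
  have "cinner x b * cinner b (the (diag_op B (\<lambda>b. f (\<mu> b)) x)) = complex_of_real (?g b)" if "b \<in> B" for b
    by (simp add: cinner_diag_op[OF B x that] of_real_cmod_square cinner_commute[of x b])
  then have sum: "((\<lambda>b. complex_of_real (?g b)) has_sum cinner x (the (diag_op B (\<lambda>b. f (\<mu> b)) x))) B"
    using Parseval[OF B, of x "the (diag_op B (\<lambda>b. f (\<mu> b)) x)"] by (subst has_sum_cong) auto
  define r where "r = Re (cinner x (the (diag_op B (\<lambda>b. f (\<mu> b)) x)))"
  have r: "(?g has_sum r) B" using has_sum_Re[OF sum] by (simp add: r_def)
  have "cinner x (the (diag_op B (\<lambda>b. f (\<mu> b)) x)) = complex_of_real r"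
    by (rule has_sum_unique[OF sum has_sum_of_real[OF r]])
  then show "cinner x (the (diag_op B (\<lambda>b. f (\<mu> b)) x))
      = complex_of_real (\<integral>s. f s \<partial>scalar_measure (diag_pvm B \<mu>) x)"
    using scalar_measure_diag_pvm_integral(2)[OF B f has_sum_imp_summable[OF r]] infsumI[OF r] by simp
qed

section \<open>Uniqueness of the spectral measure\<close>

text \<open>Polarization: over the complex numbers the diagonal matrix elements of the difference determine all
  the others, and density of the domain removes the test vector.\<close>

lemma quadratic_form_zero_imp_zero:
  assumes lin: "op_linear S" "op_linear T" and dom: "dom S = dom T" and dense: "closure (dom T) = UNIV"
    and eq: "\<And>x. x \<in> dom T \<Longrightarrow> cinner x (the (S x)) = cinner x (the (T x))"
  shows "S = T"
proof -
  define d where "d x = the (S x) - the (T x)" for x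
  have d_add: "d (x + y) = d x + d y" if "x \<in> dom T" "y \<in> dom T" for x y
    using that op_linear_simps[OF lin(1)] op_linear_simps[OF lin(2)] unfolding dom d_def by simp
  have d_scale: "d (c *\<^sub>C x) = c *\<^sub>C d x" if "x \<in> dom T" for x c
    using that op_linear_simps[OF lin(1)] op_linear_simps[OF lin(2)] unfolding dom d_def
    by (simp add: scaleC.diff_right)
  have quad: "cinner x (d x) = 0" if "x \<in> dom T" for x
    using eq[OF that] by (simp add: d_def cinner.diff_right)
  have anti: "cinner x (d y) + cinner y (d x) = 0" if "x \<in> dom T" "y \<in> dom T" for x y
    using quad[OF op_linear_simps(5)[OF lin(2) that]] quad[OF that(1)] quad[OF that(2)]
    by (simp add: d_add that cinner.add_left cinner.add_right add.commute)
  have "cinner (d y) x = 0" if "x \<in> dom T" "y \<in> dom T" for x y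
  proof -
    have "\<i> * cinner x (d y) - \<i> * cinner y (d x) = 0"
      using anti[OF that(1) op_linear_simps(3)[OF lin(2) that(2), of \<i>]]
      by (simp add: d_scale that cinner_scaleC_left cinner_scaleC_right)
    then have "\<i> * (cinner x (d y) - cinner y (d x)) = 0" by (simp add: algebra_simps)
    then have "cinner x (d y) = 0" using anti[OF that] by simp
    then show ?thesis by (metis cinner_commute complex_cnj_zero)
  qed
  then have "d y = 0" if "y \<in> dom T" for y
    using dense_cinner_eq_0[OF dense] that by blast
  then show ?thesis
    using dom by (intro ext option.expand) (auto simp: d_def domIff)
qed

lemma spectral_integral_unique:
  assumes "is_spectral_integral E f S" "is_spectral_integral E f T" "closure (dom T) = UNIV"
  shows "S = T"
  using assms quadratic_form_zero_imp_zero[of S T] unfolding is_spectral_integral_def by metis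

context
  fixes B :: "'a::chilbert_space set" and \<mu> :: "'a \<Rightarrow> real" and F
  assumes B: "orthonormal_basis B"
    and F: "projection_valued_measure F" and int: "is_spectral_integral F (\<lambda>s. s) (diag_op B \<mu>)"
begin

lemma pvm_simps:
  assumes "S \<in> sets borel"
  shows "T \<in> sets borel \<Longrightarrow> F S (F T x) = F (S \<inter> T) x"
    and "bounded_clinear (F S)" and "cinner (F S x) y = cinner x (F S y)" and "F UNIV x = x"
  using F assms unfolding projection_valued_measure_def by (auto simp: comp_def)

lemma pvm_cinner_Int:
  assumes "S \<in> sets borel" "T \<in> sets borel"
  shows "cinner (F S x) (F T x) = complex_of_real ((norm (F (S \<inter> T) x))\<^sup>2)"
  unfolding cinner_self[symmetric]
  using pvm_simps(1)[of "S \<inter> T" "S \<inter> T"] assms by (simp add: pvm_simps)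

lemma scalar_measure_restrict:
  assumes S: "S \<in> sets borel"
  shows "scalar_measure F (F S x) = density (scalar_measure F x) (indicator S)"
proof (rule measure_eqI)
  fix A assume "A \<in> sets (scalar_measure F (F S x))"
  then have A: "A \<in> sets borel" by simp
  have "emeasure (density (scalar_measure F x) (indicator S)) A
      = emeasure (scalar_measure F x) (S \<inter> A)"
    using S A by (subst emeasure_density) (auto simp: nn_integral_indicator[symmetric] indicator_inter_arith)
  then show "emeasure (scalar_measure F (F S x)) A = emeasure (density (scalar_measure F x) (indicator S)) A"
    using S A by (simp add: emeasure_scalar_measure[OF F] pvm_simps Int_commute)
qed simp

text \<open>The vector \<open>2 F(S) x - x\<close> is the image of \<open>x\<close> under a unitary that commutes with the spectral
  projections.\<close>

lemma scalar_measure_reflect: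
  assumes S: "S \<in> sets borel"
  shows "scalar_measure F (2 *\<^sub>R F S x - x) = scalar_measure F x"
proof (rule measure_eqI)
  fix A assume "A \<in> sets (scalar_measure F (2 *\<^sub>R F S x - x))"
  then have A: "A \<in> sets borel" by simp
  interpret FA: bounded_linear "F A" using pvm_simps(2)[OF A] by (simp add: bounded_clinear_iff)
  let ?u = "F (A \<inter> S) x" and ?v = "F A x"
  have "inner ?u ?v = inner ?u ?u"
    using pvm_cinner_Int[of "A \<inter> S" A x] A S
    by (simp add: inner_eq_Re_cinner cinner_self Int_absorb1 Int_commute Int_left_commute)
  then have "(norm (2 *\<^sub>R ?u - ?v))\<^sup>2 = (norm ?v)\<^sup>2"
    unfolding power2_norm_eq_inner by (simp add: inner_diff inner_commute)
  then show "emeasure (scalar_measure F (2 *\<^sub>R F S x - x)) A = emeasure (scalar_measure F x) A"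
    by (simp add: emeasure_scalar_measure[OF F A] FA.diff FA.scaleR pvm_simps A S)
qed simp

text \<open>Only the diagonal matrix elements of the operator are known as integrals against \<open>F\<close>. Since \<open>b\<close>
  and its reflection \<open>2 F(S) b - b\<close> have the same scalar measure, the quadratic form takes the same
  value at both, and expanding it shows that the value at \<open>x = F(S) b\<close> is the real part of
  \<open>\<langle>b, T x\<rangle>\<close>, which the eigenvector equation for \<open>b\<close> evaluates.\<close>

lemma pvm_diag_op_quadratic:
  assumes S: "S \<in> sets borel" and b: "b \<in> B"
  shows "integrable (scalar_measure F (F S b)) (\<lambda>s. s)"
    and "(\<integral>s. s \<partial>scalar_measure F (F S b)) = \<mu> b * (norm (F S b))\<^sup>2"
proof -
  let ?T = "diag_op B \<mu>" and ?x = "F S b"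
  note lin = op_linear_simps[OF op_linear_diag_op[OF B, of \<mu>]]
  have dom: "y \<in> dom ?T \<longleftrightarrow> integrable (scalar_measure F y) (\<lambda>s. s\<^sup>2)" for y
    using int unfolding is_spectral_integral_def by auto
  have quad: "cinner y (the (?T y)) = complex_of_real (\<integral>s. s \<partial>scalar_measure F y)" if "y \<in> dom ?T" for y
    using int that unfolding is_spectral_integral_def by blast
  have Tb: "?T b = Some (complex_of_real (\<mu> b) *\<^sub>C b)" by (rule diag_op_basis[OF B b])
  then have bd: "b \<in> dom ?T" by auto
  have ind: "(indicator S :: real \<Rightarrow> ennreal) = (\<lambda>s. ennreal (indicator S s))"
    by (auto simp: indicator_def)
  have "integrable (scalar_measure F b) (\<lambda>s. indicator S s *\<^sub>R s\<^sup>2)"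
    by (rule Bochner_Integration.integrable_bound[OF bd[unfolded dom]])
      (use S in \<open>auto simp: indicator_def\<close>)
  then have xd: "?x \<in> dom ?T"
    using S unfolding dom scalar_measure_restrict[OF S] ind by (subst integrable_density) auto
  have "integrable (scalar_measure F ?x) (\<lambda>s. 1 + s\<^sup>2)"
  proof -
    have "finite_measure (scalar_measure F ?x)"
      by (rule finite_measureI) (simp add: emeasure_scalar_measure[OF F])
    then show ?thesis using xd unfolding dom
      by (intro Bochner_Integration.integrable_add finite_measure.integrable_const) auto
  qed
  then show "integrable (scalar_measure F ?x) (\<lambda>s. s)"
  proof (rule Bochner_Integration.integrable_bound)
    have "norm s \<le> norm (1 + s\<^sup>2)" for s :: real
      using zero_le_power2[of "\<bar>s\<bar> - 1"] by (simp add: power2_eq_square algebra_simps abs_if split: if_splits)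
    then show "AE s in scalar_measure F ?x. norm s \<le> norm (1 + s\<^sup>2)" by simp
  qed simp
  have xd2: "2 *\<^sub>R ?x \<in> dom ?T" unfolding scaleR_scaleC by (rule lin(3)[OF xd])
  have reflect: "cinner (2 *\<^sub>R ?x - b) (the (?T (2 *\<^sub>R ?x - b))) = cinner b (the (?T b))"
    using lin(7)[OF xd2 bd] quad bd by (simp add: scalar_measure_reflect[OF S])
  have T2: "the (?T (2 *\<^sub>R ?x - b)) = 2 *\<^sub>R the (?T ?x) - the (?T b)"
    unfolding lin(8)[OF xd2 bd] by (simp add: scaleR_scaleC lin(4)[OF xd])
  have xb: "cinner ?x b = complex_of_real ((norm ?x)\<^sup>2)" "cinner b ?x = complex_of_real ((norm ?x)\<^sup>2)"
    using pvm_cinner_Int[of S UNIV b] pvm_cinner_Int[of UNIV S b] S by (simp_all add: pvm_simps)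
  have "cinner b (the (?T ?x)) = \<mu> b * cinner b ?x"
    using cinner_diag_op[OF B xd b] by simp
  then have "cinner ?x (the (?T ?x)) = complex_of_real (\<mu> b * (norm ?x)\<^sup>2)"
    using reflect unfolding T2
    by (simp add: cinner.diff_left cinner.diff_right cinner.scaleR_left cinner.scaleR_right Tb
        cinner_scaleC_right xb scaleR_conv_of_real algebra_simps)
  then show "(\<integral>s. s \<partial>scalar_measure F ?x) = \<mu> b * (norm ?x)\<^sup>2"
    unfolding quad[OF xd] of_real_eq_iff .
qed

text \<open>On \<open>S\<close> the function \<open>s - \<mu> b\<close> has a strict sign, but its integral against the scalar measure of
  \<open>F(S) b\<close>, which lives on \<open>S\<close>, is zero.\<close>

lemma pvm_one_sided_zero:
  assumes S: "S \<in> sets borel" and b: "b \<in> B" and side: "S = {\<mu> b<..} \<or> S = {..<\<mu> b}"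
  shows "F S b = 0"
proof -
  let ?M = "scalar_measure F (F S b)"
  define \<sigma> :: real where "\<sigma> = (if S = {\<mu> b<..} then 1 else - 1)"
  have pos: "0 < \<sigma> * (s - \<mu> b)" if "s \<in> S" for s
    using that side by (auto simp: \<sigma>_def)
  have fin: "finite_measure ?M"
    by (rule finite_measureI) (simp add: emeasure_scalar_measure[OF F])
  have mass: "measure ?M UNIV = (norm (F S b))\<^sup>2"
    using emeasure_scalar_measure[OF F, of UNIV "F S b"] pvm_simps(4)[of UNIV]
    by (simp add: measure_def)
  have "AE s in ?M. s \<in> S"
    unfolding scalar_measure_restrict[OF S] using S
    by (subst AE_density) (auto simp: indicator_def)
  then have ae: "AE s in ?M. 0 < \<sigma> * (s - \<mu> b)" by eventually_elim (rule pos)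
  have int_c: "integrable ?M (\<lambda>s. \<mu> b)" by (rule finite_measure.integrable_const[OF fin])
  have int': "integrable ?M (\<lambda>s. \<sigma> * (s - \<mu> b))"
    using pvm_diag_op_quadratic(1)[OF S b] int_c by auto
  have "(\<integral>s. \<sigma> * (s - \<mu> b) \<partial>?M) = 0"
    using pvm_diag_op_quadratic[OF S b] int_c
    by (simp add: mass)
  then have "AE s in ?M. \<sigma> * (s - \<mu> b) = 0"
    by (rule integral_nonneg_eq_0_iff_AE[OF int', THEN iffD1, rotated]) (use ae in \<open>eventually_elim, simp\<close>)
  with ae have "AE s in ?M. False" by eventually_elim auto
  then have "emeasure ?M (space ?M) = 0" by (subst (asm) AE_iff_measurable[OF sets.top]) auto
  then show ?thesis
    using emeasure_scalar_measure[OF F, of UNIV "F S b"] pvm_simps(4)[of UNIV] by simp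
qed

text \<open>By the preceding lemma the scalar measure of \<open>b\<close> is concentrated in the point \<open>\<mu> b\<close>, that is,
  \<open>F({\<mu> b}) b = b\<close>; then \<open>F(S) b = F(S \<inter> {\<mu> b}) b\<close>.\<close>

lemma pvm_eigenvector:
  assumes S: "S \<in> sets borel" and b: "b \<in> B"
  shows "F S b = (if \<mu> b \<in> S then b else 0)"
proof -
  let ?M = "scalar_measure F b"
  have UNIV_eq: "UNIV = {..<\<mu> b} \<union> {\<mu> b} \<union> {\<mu> b<..}" by auto
  have e1: "emeasure ?M ({..<\<mu> b} \<union> {\<mu> b}) = emeasure ?M {..<\<mu> b} + emeasure ?M {\<mu> b}"
    by (rule plus_emeasure[symmetric]) auto
  have "emeasure ?M ({..<\<mu> b} \<union> {\<mu> b} \<union> {\<mu> b<..})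
      = emeasure ?M ({..<\<mu> b} \<union> {\<mu> b}) + emeasure ?M {\<mu> b<..}"
    by (rule plus_emeasure[symmetric]) auto
  then have "ennreal ((norm b)\<^sup>2) = ennreal ((norm (F {\<mu> b} b))\<^sup>2)"
    unfolding UNIV_eq[symmetric] e1
    by (simp add: emeasure_scalar_measure[OF F] pvm_one_sided_zero[OF _ b] pvm_simps(4)[of UNIV])
  then have norm_eq: "(norm b)\<^sup>2 = (norm (F {\<mu> b} b))\<^sup>2" by (simp add: ennreal_inj)
  have "inner (F {\<mu> b} b) b = (norm (F {\<mu> b} b))\<^sup>2"
    using pvm_cinner_Int[of "{\<mu> b}" UNIV b] by (simp add: pvm_simps(4)[of UNIV] inner_eq_Re_cinner)
  then have "(norm (F {\<mu> b} b - b))\<^sup>2 = 0"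
    using norm_eq unfolding power2_norm_eq_inner by (simp add: inner_diff inner_commute)
  then have fixed: "F {\<mu> b} b = b" by simp
  have "emeasure ?M {} = 0" by simp
  then have "F {} b = 0" by (simp only: emeasure_scalar_measure[OF F sets.empty_sets]) simp
  moreover have "F S b = F (S \<inter> {\<mu> b}) b"
    using pvm_simps(1)[OF S, of "{\<mu> b}" b] fixed by simp
  ultimately show ?thesis using fixed by (auto simp: Int_insert_right)
qed

lemma pvm_eq_diag_pvm: "F = diag_pvm B \<mu>"
proof (intro ext)
  fix S x
  show "F S x = diag_pvm B \<mu> S x"
  proof (cases "S \<in> sets borel")
    case True
    have clin: "bounded_linear (F S)" "\<And>c x. F S (c *\<^sub>C x) = c *\<^sub>C F S x"
      using pvm_simps(2)[OF True] by (auto simp: bounded_clinear_iff)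
    have "((\<lambda>b. F S (cinner b x *\<^sub>C b)) has_sum F S x) B"
      by (rule has_sum_bounded_linear[OF clin(1) orthonormal_basis_expansion[OF B]])
    then have "((\<lambda>b. cinner b x *\<^sub>C b) has_sum F S x) {b\<in>B. \<mu> b \<in> S}"
      by (rule has_sum_cong_neutral[THEN iffD1, rotated -1])
        (auto simp: clin(2) pvm_eigenvector[OF True] scaleC.zero_right)
    then show ?thesis using diag_pvm_has_sum[OF B True] has_sum_unique by blast
  next
    case False
    then show ?thesis using F by (simp add: diag_pvm_def projection_valued_measure_def)
  qed
qed

end

theorem spectral_measure_diag_op:
  fixes B :: "'a::chilbert_space set"
  assumes B: "orthonormal_basis B"
  shows "spectral_measure (diag_op B \<mu>) = diag_pvm B \<mu>"
  unfolding spectral_measure_def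
proof (rule the_equality)
  show "projection_valued_measure (diag_pvm B \<mu>) \<and> is_spectral_integral (diag_pvm B \<mu>) (\<lambda>s. s) (diag_op B \<mu>)"
    using projection_valued_measure_diag_pvm[OF B] is_spectral_integral_diag_op[OF B, of "\<lambda>s. s"] by simp
qed (use pvm_eq_diag_pvm[OF B] in blast)

theorem fun_calc_diag_op:
  fixes B :: "'a::chilbert_space set"
  assumes B: "orthonormal_basis B" and f: "f \<in> borel_measurable borel"
  shows "fun_calc (diag_op B \<mu>) f = diag_op B (\<lambda>b. f (\<mu> b))"
  unfolding fun_calc_def spectral_measure_diag_op[OF B]
  using is_spectral_integral_diag_op[OF B f] spectral_integral_unique dense_dom_diag_op[OF B]
  by (intro the_equality) blast+

section \<open>Traces in an eigenbasis\<close>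

lemma ennreal_infsum:
  fixes h :: "'a \<Rightarrow> real"
  assumes "\<And>x. x \<in> A \<Longrightarrow> 0 \<le> h x" "h summable_on A"
  shows "(\<Sum>\<^sub>\<infinity>x\<in>A. ennreal (h x)) = ennreal (infsum h A)"
proof -
  have "ennreal (infsum h A) = (SUP F\<in>{F. finite F \<and> F \<subseteq> A}. ennreal (sum h F))"
    by (rule infsum_nonneg_is_SUPREMUM_ennreal[OF assms(2,1)])
  also have "\<dots> = (SUP F\<in>{F. finite F \<and> F \<subseteq> A}. \<Sum>x\<in>F. ennreal (h x))"
    by (rule SUP_cong) (use assms(1) in \<open>auto intro!: sum_ennreal[symmetric]\<close>)
  also have "\<dots> = (\<Sum>\<^sub>\<infinity>x\<in>A. ennreal (h x))"
    by (subst nonneg_infsum_complete) (auto intro: SUP_cong)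
  finally show ?thesis by simp
qed

lemma summable_on_if_infsum_ennreal_finite:
  fixes h :: "'a \<Rightarrow> real"
  assumes nonneg: "\<And>x. x \<in> A \<Longrightarrow> 0 \<le> h x" and fin: "(\<Sum>\<^sub>\<infinity>x\<in>A. ennreal (h x)) < \<infinity>"
  shows "h summable_on A"
proof (rule nonneg_bdd_above_summable_on[OF nonneg])
  obtain r where r: "(\<Sum>\<^sub>\<infinity>x\<in>A. ennreal (h x)) = ennreal r" "0 \<le> r"
    using fin by (cases "\<Sum>\<^sub>\<infinity>x\<in>A. ennreal (h x)") auto
  show "bdd_above (sum h ` {F. F \<subseteq> A \<and> finite F})"
  proof (rule bdd_aboveI2)
    fix F assume "F \<in> {F. F \<subseteq> A \<and> finite F}"
    then have F: "F \<subseteq> A" "finite F" by auto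
    then have "ennreal (sum h F) = (\<Sum>x\<in>F. ennreal (h x))"
      using nonneg by (subst sum_ennreal) auto
    also have "\<dots> \<le> ennreal r"
      unfolding r(1)[symmetric] using F by (subst nonneg_infsum_complete) (auto intro!: SUP_upper)
    finally show "sum h F \<le> r" using r(2) by (simp add: ennreal_le_iff)
  qed
qed

lemma orthonormal_basis_some_onb:
  assumes "orthonormal_basis (B :: 'a::complex_inner set)"
  shows "orthonormal_basis (some_onb :: 'a set)"
  unfolding some_onb_def by (rule someI[of orthonormal_basis, OF assms])

context
  fixes B :: "'a::chilbert_space set" and g :: "'a \<Rightarrow> real" and C :: real
  assumes B: "orthonormal_basis B" and g: "\<And>b. b \<in> B \<Longrightarrow> 0 \<le> g b \<and> g b \<le> C"
begin

lemma dom_diag_op_UNIV: "x \<in> dom (diag_op B g)"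
  using diag_op_bounded(1)[OF B, of g C] g by auto

text \<open>All terms of the double sum over both bases are nonnegative, so finiteness of the iterated sum on
  one side allows the order of summation to be exchanged.\<close>

lemma pos_trace_diag_op:
  assumes fin: "pos_trace (\<lambda>x. the (diag_op B g x)) < \<infinity>"
  shows "g summable_on B" and "pos_trace (\<lambda>x. the (diag_op B g x)) = ennreal (infsum g B)"
proof -
  let ?U = "some_onb :: 'a set" and ?T = "\<lambda>x. the (diag_op B g x)"
  note U = orthonormal_basis_some_onb[OF B]
  define h where "h e = Re (cinner e (?T e))" for e
  define f where "f e b = g b * (cmod (cinner b e))\<^sup>2" for e b
  have f_nonneg: "0 \<le> f e b" if "b \<in> B" for e b using g[OF that] by (simp add: f_def)
  have f_h: "(f e has_sum h e) B" for e
  proof -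
    have "Re (cinner e b * cinner b (?T e)) = f e b" if "b \<in> B" for b
      by (simp add: cinner_diag_op[OF B dom_diag_op_UNIV that] f_def cinner_commute[of e b]
          mult.left_commute flip: of_real_cmod_square)
        (metis cmod_power2 power2_eq_square mult.left_commute)
    then show ?thesis
      using has_sum_Re[OF Parseval[OF B, of e "?T e"]] unfolding h_def by (subst has_sum_cong) auto
  qed
  have f_g: "((\<lambda>e. f e b) has_sum g b) ?U" if "b \<in> B" for b
  proof -
    have "((\<lambda>e. g b * (cmod (cinner e b))\<^sup>2) has_sum g b * (norm b)\<^sup>2) ?U"
      by (rule has_sum_cmult_right[OF Parseval_norm[OF U]])
    moreover have "norm b = 1" by (rule orthonormal_norm[OF orthonormal_basis_orthonormal[OF B] that])
    moreover have "cmod (cinner e b) = cmod (cinner b e)" for e by (metis cinner_commute complex_mod_cnj)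
    ultimately show ?thesis by (simp add: f_def)
  qed
  have h_nonneg: "0 \<le> h e" for e using has_sum_nonneg[OF f_h] f_nonneg by blast
  have trace: "pos_trace ?T = (\<Sum>\<^sub>\<infinity>e\<in>?U. ennreal (h e))" by (simp add: pos_trace_def h_def)
  have h_sum: "h summable_on ?U"
    by (rule summable_on_if_infsum_ennreal_finite[OF h_nonneg fin[unfolded trace]])
  have "(\<lambda>x. norm ((\<lambda>(e, b). f e b) x)) summable_on ?U \<times> B"
    unfolding Infinite_Sum.abs_summable_on_Sigma_iff
  proof (intro conjI ballI)
    have eq: "(\<lambda>b. norm (f e b)) summable_on B \<longleftrightarrow> f e summable_on B" for e
      by (rule summable_on_cong) (simp add: f_nonneg)
    show "(\<lambda>b. norm (case (e, b) of (e, b) \<Rightarrow> f e b)) summable_on B" for e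
      using has_sum_imp_summable[OF f_h] eq by simp
    have "(\<Sum>\<^sub>\<infinity>b\<in>B. norm (f e b)) = h e" for e
      using f_h[THEN infsumI, of e] f_nonneg by (metis (no_types, lifting) infsum_cong abs_of_nonneg real_norm_def)
    then show "(\<lambda>e. norm (\<Sum>\<^sub>\<infinity>b\<in>B. norm (case (e, b) of (e, b) \<Rightarrow> f e b))) summable_on ?U"
      using h_sum h_nonneg by simp
  qed
  then have sum: "(\<lambda>(e, b). f e b) summable_on ?U \<times> B" by (rule Infinite_Sum.abs_summable_summable)
  then have "(\<lambda>(b, e). f e b) summable_on B \<times> ?U"
    by (subst summable_on_swap) simp
  then have "(\<lambda>b. \<Sum>\<^sub>\<infinity>e\<in>?U. f e b) summable_on B" by (rule summable_on_Sigma_banach)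
  also have "?this \<longleftrightarrow> g summable_on B" by (rule summable_on_cong) (simp add: infsumI[OF f_g])
  finally show "g summable_on B" .
  have "infsum h ?U = (\<Sum>\<^sub>\<infinity>e\<in>?U. \<Sum>\<^sub>\<infinity>b\<in>B. f e b)" by (rule infsum_cong) (simp add: infsumI[OF f_h])
  also have "\<dots> = (\<Sum>\<^sub>\<infinity>b\<in>B. \<Sum>\<^sub>\<infinity>e\<in>?U. f e b)" by (rule infsum_swap_banach[OF sum])
  also have "\<dots> = infsum g B" by (rule infsum_cong) (simp add: infsumI[OF f_g])
  finally show "pos_trace ?T = ennreal (infsum g B)"
    unfolding trace using ennreal_infsum[OF h_nonneg h_sum] by simp
qed

text \<open>The matrix elements \<open>g b \<langle>b, e\<rangle> \<langle>e, a b\<rangle>\<close> form an absolutely summable double family: the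
  inequality of arithmetic and geometric means bounds the sum over \<open>e\<close> of their absolute values by
  a multiple of \<open>g b\<close>. Summing over \<open>e\<close> first gives \<open>g b \<langle>b, a b\<rangle>\<close> by Parseval, summing over \<open>b\<close>
  first gives the trace.\<close>

lemma op_trace_comp_diag_op:
  assumes a: "bounded_clinear a" and g_sum: "g summable_on B"
  shows "((\<lambda>b. complex_of_real (g b) * cinner b (a b)) has_sum op_trace (a \<circ> (\<lambda>x. the (diag_op B g x)))) B"
proof -
  let ?U = "some_onb :: 'a set" and ?T = "\<lambda>x. the (diag_op B g x)"
  note U = orthonormal_basis_some_onb[OF B]
  have a': "bounded_linear a" "\<And>c x. a (c *\<^sub>C x) = c *\<^sub>C a x" using a by (auto simp: bounded_clinear_iff)
  obtain K where K: "\<And>x. norm (a x) \<le> norm x * K" using bounded_linear.bounded[OF a'(1)] by blast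
  define f where "f b e = complex_of_real (g b) * (cinner b e * cinner e (a b))" for b e
  define m where "m b e = g b * (((cmod (cinner e b))\<^sup>2 + (cmod (cinner e (a b)))\<^sup>2) / 2)" for b e
  have f_m: "norm (f b e) \<le> m b e" if "b \<in> B" for b e
  proof -
    have "cmod (cinner b e) = cmod (cinner e b)" by (metis cinner_commute complex_mod_cnj)
    then have "cmod (cinner b e) * cmod (cinner e (a b)) \<le> ((cmod (cinner e b))\<^sup>2 + (cmod (cinner e (a b)))\<^sup>2) / 2"
      using sum_squares_bound[of "cmod (cinner e b)" "cmod (cinner e (a b))"] by simp
    then show ?thesis
      using g[OF that] unfolding f_def m_def norm_mult by (simp add: mult_left_mono del: mult_le_cancel_left times_divide_eq_right)
  qed
  have m_sum: "(m b has_sum g b * (((norm b)\<^sup>2 + (norm (a b))\<^sup>2) / 2)) ?U" for b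
    unfolding m_def
    by (intro has_sum_cmult_right has_sum_divide_const has_sum_add Parseval_norm[OF U])
  have f_abs: "(\<lambda>e. norm (f b e)) summable_on ?U" if "b \<in> B" for b
    by (rule Infinite_Sum.abs_summable_on_comparison_test'[OF has_sum_imp_summable[OF m_sum] f_m[OF that]])
  have "(\<lambda>x. norm ((\<lambda>(b, e). f b e) x)) summable_on B \<times> ?U"
    unfolding Infinite_Sum.abs_summable_on_Sigma_iff
  proof (intro conjI ballI)
    show "(\<lambda>e. norm (case (b, e) of (b, e) \<Rightarrow> f b e)) summable_on ?U" if "b \<in> B" for b
      using f_abs[OF that] by simp
    have "norm (\<Sum>\<^sub>\<infinity>e\<in>?U. norm (f b e)) \<le> g b * ((1 + K\<^sup>2) / 2)" if b: "b \<in> B" for b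
    proof -
      have nb: "norm b = 1" by (rule orthonormal_norm[OF orthonormal_basis_orthonormal[OF B] b])
      have "(\<Sum>\<^sub>\<infinity>e\<in>?U. norm (f b e)) \<le> g b * (((norm b)\<^sup>2 + (norm (a b))\<^sup>2) / 2)"
        by (rule has_sum_mono[OF has_sum_infsum[OF f_abs[OF b]] m_sum]) (rule f_m[OF b])
      also have "\<dots> \<le> g b * ((1 + K\<^sup>2) / 2)"
        using g[OF b] power_mono[OF K[of b] norm_ge_zero, of 2]
        by (intro mult_left_mono) (auto simp: nb)
      finally show ?thesis by (simp add: infsum_nonneg)
    qed
    then show "(\<lambda>b. norm (\<Sum>\<^sub>\<infinity>e\<in>?U. norm (case (b, e) of (b, e) \<Rightarrow> f b e))) summable_on B"
      by (intro Infinite_Sum.abs_summable_on_comparison_test'[OF summable_on_cmult_left[OF g_sum, of "(1 + K\<^sup>2) / 2"]]) simp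
  qed
  then have sum: "(\<lambda>(b, e). f b e) summable_on B \<times> ?U" by (rule Infinite_Sum.abs_summable_summable)
  have f_b: "(\<Sum>\<^sub>\<infinity>e\<in>?U. f b e) = complex_of_real (g b) * cinner b (a b)" for b
    unfolding f_def by (rule infsumI[OF has_sum_cmult_right[OF Parseval[OF U]]])
  have f_e: "(\<Sum>\<^sub>\<infinity>b\<in>B. f b e) = cinner e (a (?T e))" for e
  proof (rule infsumI)
    have "((\<lambda>b. cinner e (a ((complex_of_real (g b) * cinner b e) *\<^sub>C b))) has_sum cinner e (a (?T e))) B"
      by (rule has_sum_bounded_linear[OF bounded_linear_compose[OF cinner.bounded_linear_right a'(1)]
            diag_op_has_sum[OF B dom_diag_op_UNIV]])
    then show "((\<lambda>b. f b e) has_sum cinner e (a (?T e))) B"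
      by (simp add: f_def a'(2) cinner_scaleC_right mult.assoc)
  qed
  have "(\<lambda>b. \<Sum>\<^sub>\<infinity>e\<in>?U. f b e) summable_on B" by (rule summable_on_Sigma_banach[OF sum])
  then have "((\<lambda>b. complex_of_real (g b) * cinner b (a b)) has_sum (\<Sum>\<^sub>\<infinity>b\<in>B. \<Sum>\<^sub>\<infinity>e\<in>?U. f b e)) B"
    unfolding f_b by simp
  also have "(\<Sum>\<^sub>\<infinity>b\<in>B. \<Sum>\<^sub>\<infinity>e\<in>?U. f b e) = (\<Sum>\<^sub>\<infinity>e\<in>?U. \<Sum>\<^sub>\<infinity>b\<in>B. f b e)"
    by (rule infsum_swap_banach[OF sum])
  also have "\<dots> = op_trace (a \<circ> ?T)" unfolding f_e by (simp add: op_trace_def)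
  finally show ?thesis .
qed

end

section \<open>Summation by parts and regular averages\<close>

text \<open>For \<open>n \<ge> M\<close>, monotonicity gives \<open>(n - M) g(n) \<le> g(M) + \<dots> + g(n - 1)\<close>, a piece of the tail of a
  convergent series, and \<open>M g(n)\<close> tends to \<open>0\<close> for fixed \<open>M\<close>.\<close>

lemma antimono_summable_mult_index_tendsto_0:
  fixes g :: "nat \<Rightarrow> real"
  assumes "antimono g" "\<And>n. 0 \<le> g n" "summable g"
  shows "(\<lambda>n. real n * g n) \<longlonglongrightarrow> 0"
proof (rule LIMSEQ_I)
  fix e :: real assume e: "0 < e"
  obtain M where M: "\<And>m n. m \<ge> M \<Longrightarrow> norm (sum g {m..<n}) < e / 2"
    using assms(3) e unfolding summable_Cauchy by (metis half_gt_zero)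
  have "(\<lambda>n. real M * g n) \<longlonglongrightarrow> 0"
    using tendsto_mult_right_zero[OF summable_LIMSEQ_zero[OF assms(3)]] .
  then obtain N where N: "\<And>n. n \<ge> N \<Longrightarrow> norm (real M * g n - 0) < e / 2"
    using e LIMSEQ_D by (metis half_gt_zero)
  have "norm (real n * g n - 0) < e" if n: "n \<ge> max M N" for n
  proof -
    have "real (n - M) * g n = (\<Sum>k\<in>{M..<n}. g n)" by simp
    also have "\<dots> \<le> sum g {M..<n}"
      by (rule sum_mono) (use assms(1) in \<open>auto intro: antimonoD\<close>)
    also have "\<dots> < e / 2" using M[of M n] by simp
    finally have "real n * g n - real M * g n < e / 2" using n by (simp add: of_nat_diff left_diff_distrib)
    moreover have "real M * g n < e / 2" using N[of n] n by auto
    ultimately show ?thesis using assms(2)[of n] by simp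
  qed
  then show "\<exists>N. \<forall>n\<ge>N. norm (real n * g n - 0) < e" by blast
qed

text \<open>Summation by parts; the boundary term is at most \<open>K N g(N)\<close>.\<close>

lemma Abel_summation_sums:
  fixes g :: "nat \<Rightarrow> real" and a :: "nat \<Rightarrow> complex"
  assumes g: "antimono g" "\<And>n. 0 \<le> g n" "summable g" and a: "\<And>n. cmod (a n) \<le> K"
    and s: "(\<lambda>n. complex_of_real (g n) * a n) sums s"
  shows "(\<lambda>n. complex_of_real (g n - g (Suc n)) * (\<Sum>k\<le>n. a k)) sums s"
proof -
  have partial: "(\<Sum>n<N. complex_of_real (g n - g (Suc n)) * (\<Sum>k\<le>n. a k))
      = (\<Sum>k<N. complex_of_real (g k) * a k) - complex_of_real (g N) * (\<Sum>k<N. a k)" for N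
    by (induction N) (simp_all add: lessThan_Suc_atMost[symmetric] algebra_simps)
  have "(\<lambda>N. complex_of_real (g N) * (\<Sum>k<N. a k)) \<longlonglongrightarrow> 0"
  proof (rule Lim_null_comparison)
    have "norm (complex_of_real (g N) * (\<Sum>k<N. a k)) \<le> K * (real N * g N)" for N
    proof -
      have "cmod (\<Sum>k<N. a k) \<le> real N * K"
        using sum_norm_le[of "{..<N}" a "\<lambda>_. K"] a by simp
      then show ?thesis
        using mult_left_mono[OF _ g(2), of "cmod (\<Sum>k<N. a k)" "real N * K" N] g(2)[of N]
        by (simp add: norm_mult mult_ac)
    qed
    then show "\<forall>\<^sub>F N in sequentially. norm (complex_of_real (g N) * (\<Sum>k<N. a k)) \<le> K * (real N * g N)"
      by simp
    show "(\<lambda>N. K * (real N * g N)) \<longlonglongrightarrow> 0"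
      by (rule tendsto_mult_right_zero[OF antimono_summable_mult_index_tendsto_0[OF g]])
  qed
  then show ?thesis using tendsto_diff[OF s[unfolded sums_def]] unfolding sums_def partial by fastforce
qed

lemma bounded_average:
  fixes x :: "nat \<Rightarrow> complex" and p :: "nat \<Rightarrow> real"
  assumes "\<And>n. 0 \<le> p n" "p sums s" "\<And>n. cmod (x n) \<le> K"
  shows "summable (\<lambda>n. complex_of_real (p n) * x n)"
    and "cmod (\<Sum>n. complex_of_real (p n) * x n) \<le> s * K"
proof -
  have le: "norm (complex_of_real (p n) * x n) \<le> p n * K" for n
    using assms(1)[of n] assms(3)[of n] by (simp add: norm_mult mult_left_mono)
  have pK: "(\<lambda>n. p n * K) sums (s * K)" by (rule sums_mult2[OF assms(2)])
  show "summable (\<lambda>n. complex_of_real (p n) * x n)"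
    by (rule summable_comparison_test'[OF sums_summable[OF pK]]) (rule le)
  show "cmod (\<Sum>n. complex_of_real (p n) * x n) \<le> s * K"
    using norm_suminf_le[OF le sums_summable[OF pK]] sums_unique[OF pK] by simp
qed

text \<open>The easy direction of the Silverman--Toeplitz theorem. Subtracting the limit reduces to null
  sequences; then the first \<open>N\<close> terms are negligible because each column tends to \<open>0\<close>, and the
  others because the sequence is small there and the weights have sum \<open>1\<close>.\<close>

lemma Toeplitz_regular:
  fixes p :: "'i \<Rightarrow> nat \<Rightarrow> real" and x :: "nat \<Rightarrow> complex"
  assumes p: "\<forall>\<^sub>F i in F. (\<forall>n. 0 \<le> p i n) \<and> p i sums 1"
    and col: "\<And>n. ((\<lambda>i. p i n) \<longlongrightarrow> 0) F" and x: "x \<longlonglongrightarrow> L"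
  shows "((\<lambda>i. \<Sum>n. complex_of_real (p i n) * x n) \<longlongrightarrow> L) F"
proof (rule tendstoI)
  fix e :: real assume e: "0 < e"
  define y where "y n = x n - L" for n
  have "y \<longlonglongrightarrow> 0" using tendsto_diff[OF x tendsto_const[of L]] by (simp add: y_def[abs_def])
  then have "Bseq y" using convergent_imp_Bseq convergent_def by blast
  then obtain K where K: "K > 0" "\<And>n. cmod (y n) \<le> K" by (auto elim: BseqE)
  obtain N where N: "\<And>n. n \<ge> N \<Longrightarrow> cmod (y n) < e / 2"
    using LIMSEQ_D[OF \<open>y \<longlonglongrightarrow> 0\<close>, of "e / 2"] e by auto
  have "((\<lambda>i. \<Sum>n<N. p i n * K) \<longlongrightarrow> (\<Sum>n<N. 0)) F"
    by (intro tendsto_sum tendsto_mult_left_zero col)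
  then have "\<forall>\<^sub>F i in F. (\<Sum>n<N. p i n * K) < e / 2"
    using order_tendstoD(2)[of _ 0 F "e / 2"] e by simp
  with p show "\<forall>\<^sub>F i in F. dist (\<Sum>n. complex_of_real (p i n) * x n) L < e"
  proof eventually_elim
    fix i assume i: "(\<forall>n. 0 \<le> p i n) \<and> p i sums 1" and small: "(\<Sum>n<N. p i n * K) < e / 2"
    have sy: "summable (\<lambda>n. complex_of_real (p i n) * y n)"
      by (rule bounded_average(1)[of "p i" 1 y K]) (use i K in auto)
    have "(\<lambda>n. complex_of_real (p i n)) sums 1" using i sums_of_real by fastforce
    from sums_add[OF summable_sums[OF sy] sums_mult2[OF this, of L]]
    have "(\<Sum>n. complex_of_real (p i n) * x n) - L = (\<Sum>n. complex_of_real (p i n) * y n)"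
      by (simp add: y_def algebra_simps sums_iff)
    moreover have "cmod (\<Sum>n. complex_of_real (p i n) * y n) \<le> (\<Sum>n<N. p i n * K) + e / 2"
    proof -
      have b: "(\<lambda>n. (if n \<in> {..<N} then p i n * K else 0) + p i n * (e / 2)) sums ((\<Sum>n<N. p i n * K) + 1 * (e / 2))"
        by (intro sums_add sums_mult2 sums_If_finite_set) (use i in auto)
      have "norm (complex_of_real (p i n) * y n) \<le> (if n \<in> {..<N} then p i n * K else 0) + p i n * (e / 2)" for n
      proof (cases "n < N")
        case True
        have "p i n * cmod (y n) \<le> p i n * K" using i K(2) by (intro mult_left_mono) auto
        then show ?thesis using True i e by (simp add: norm_mult add_increasing2)
      next
        case False
        have "p i n * cmod (y n) \<le> p i n * (e / 2)" using i N[of n] False by (intro mult_left_mono) auto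
        then show ?thesis using False i by (simp add: norm_mult)
      qed
      from norm_suminf_le[OF this sums_summable[OF b]] show ?thesis using sums_unique[OF b] by simp
    qed
    ultimately show "dist (\<Sum>n. complex_of_real (p i n) * x n) L < e"
      using small by (simp add: dist_norm)
  qed
qed

text \<open>Finitely many terms are irrelevant: the difference is a null sequence.\<close>

lemma extended_limit_cong:
  assumes \<omega>: "extended_limit \<omega>" and x: "Bseq x" and eq: "\<forall>\<^sub>F n in sequentially. x n = y n"
  shows "\<omega> x = \<omega> y"
proof -
  have "(\<lambda>n. y n - x n) \<longlonglongrightarrow> 0"
    by (rule tendsto_eventually) (use eq in \<open>eventually_elim, simp\<close>)
  moreover from this have "Bseq (\<lambda>n. y n - x n)" using convergent_imp_Bseq convergent_def by blast
  ultimately have "\<omega> (\<lambda>n. x n + (y n - x n)) = \<omega> x + 0"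
    using \<omega> x unfolding extended_limit_def linf_state_def by metis
  then show ?thesis by simp
qed

text \<open>Averaging with a regular nonnegative matrix is a positive unital map of the bounded sequences that
  preserves null sequences. Applied to the Abel weights it produces the extended limit that is to
  be found.\<close>

lemma extended_limit_Toeplitz:
  assumes \<omega>: "extended_limit \<omega>"
    and p: "\<And>m n. 0 \<le> p m n" "\<And>m. p m sums (1::real)" "\<And>n. (\<lambda>m. p m n) \<longlonglongrightarrow> 0"
  shows "extended_limit (\<lambda>x. \<omega> (\<lambda>m. \<Sum>n. complex_of_real (p m n) * x n))" (is "extended_limit (\<lambda>x. \<omega> (?\<Phi> x))")
proof -
  have \<omega>_add: "\<omega> (\<lambda>n. x n + y n) = \<omega> x + \<omega> y" if "Bseq x" "Bseq y" for x y
    using \<omega> that unfolding extended_limit_def linf_state_def by blast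
  have \<omega>_scale: "\<omega> (\<lambda>n. c * x n) = c * \<omega> x" if "Bseq x" for c x
    using \<omega> that unfolding extended_limit_def linf_state_def by blast
  have \<omega>_pos: "\<omega> x \<in> \<real>\<^sub>\<ge>\<^sub>0" if "Bseq x" "\<And>n. x n \<in> \<real>\<^sub>\<ge>\<^sub>0" for x
    using \<omega> that unfolding extended_limit_def linf_state_def by blast
  have summ: "summable (\<lambda>n. complex_of_real (p m n) * x n)" if "Bseq x" for m x
    using that bounded_average(1)[OF p(1,2)] by (metis BseqE)
  have bdd: "Bseq (?\<Phi> x)" if x: "Bseq x" for x
  proof -
    obtain K where "\<And>n. cmod (x n) \<le> K" using x by (metis BseqE)
    from bounded_average(2)[OF p(1,2) this] show ?thesis by (intro BseqI'[of _ K]) simp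
  qed
  show ?thesis
    unfolding extended_limit_def linf_state_def
  proof (intro conjI allI impI)
    fix x y :: "nat \<Rightarrow> complex" and c assume x: "Bseq x"
    show "\<omega> (?\<Phi> (\<lambda>n. c * x n)) = c * \<omega> (?\<Phi> x)"
      using suminf_mult[OF summ[OF x], of c] \<omega>_scale[OF bdd[OF x], of c] by (simp add: mult.left_commute)
    assume y: "Bseq y"
    show "\<omega> (?\<Phi> (\<lambda>n. x n + y n)) = \<omega> (?\<Phi> x) + \<omega> (?\<Phi> y)"
      using suminf_add[OF summ[OF x] summ[OF y]] \<omega>_add[OF bdd[OF x] bdd[OF y]] by (simp add: distrib_left)
  next
    fix x :: "nat \<Rightarrow> complex" assume x: "Bseq x" "\<forall>n. x n \<in> \<real>\<^sub>\<ge>\<^sub>0"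
    have "?\<Phi> x m \<in> \<real>\<^sub>\<ge>\<^sub>0" for m
    proof -
      define r where "r n = Re (x n)" for n
      have xr: "x n = complex_of_real (r n)" and r: "0 \<le> r n" for n
        using x(2) by (auto simp: complex_nonneg_Reals_iff complex_eq_iff r_def)
      have s: "summable (\<lambda>n. p m n * r n)"
        using summ[OF x(1), of m] unfolding xr of_real_mult[symmetric] by (simp only: summable_of_real_iff)
      have "?\<Phi> x m = complex_of_real (\<Sum>n. p m n * r n)"
        unfolding xr of_real_mult[symmetric] by (rule suminf_of_real[OF s, symmetric])
      then show ?thesis using suminf_nonneg[OF s] p(1) r by simp
    qed
    then show "\<omega> (?\<Phi> x) \<in> \<real>\<^sub>\<ge>\<^sub>0" by (intro \<omega>_pos bdd x)
  next
    have "(\<Sum>n. complex_of_real (p m n)) = 1" for m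
      using sums_of_real[OF p(2), of m] sums_unique by fastforce
    then show "\<omega> (?\<Phi> (\<lambda>_. 1)) = 1"
      using \<omega> unfolding extended_limit_def linf_state_def by simp
  next
    fix x :: "nat \<Rightarrow> complex" assume "x \<longlonglongrightarrow> 0"
    then have "?\<Phi> x \<longlonglongrightarrow> 0" by (intro Toeplitz_regular) (simp_all add: p)
    then show "\<omega> (?\<Phi> x) = 0" using \<omega> unfolding extended_limit_def by blast
  qed
qed

section \<open>Eigenvalue enumeration and Abel weights\<close>

text \<open>The coefficient of the mean over the first \<open>n + 1\<close> eigenvalues when \<open>\<Sum>\<^sub>k e\<^bsup>-t\<lambda>\<^sub>k\<^esup> a\<^sub>k\<close> is summed by
  parts and divided by the partition function.\<close>

definition Abel_weight :: "(nat \<Rightarrow> real) \<Rightarrow> real \<Rightarrow> nat \<Rightarrow> real" where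
  "Abel_weight ev t n =
     real (Suc n) * (exp (- t * ev n) - exp (- t * ev (Suc n))) / (\<Sum>n. exp (- t * ev n))"

text \<open>For \<open>a\<^sub>k = \<langle>b\<^sub>k, a b\<^sub>k\<rangle>\<close> this is \<open>Tr (P\<^sub>l a P\<^sub>l) / Tr P\<^sub>l\<close>.\<close>

definition cutoff_mean :: "(nat \<Rightarrow> real) \<Rightarrow> (nat \<Rightarrow> complex) \<Rightarrow> real \<Rightarrow> complex" where
  "cutoff_mean ev a l = (\<Sum>k | ev k \<le> l. a k) / of_nat (card {k. ev k \<le> l})"

lemma cmod_cutoff_mean_le:
  assumes "\<And>n. cmod (a n) \<le> K"
  shows "cmod (cutoff_mean ev a l) \<le> K"
proof -
  have "cmod (\<Sum>k | ev k \<le> l. a k) \<le> real (card {k. ev k \<le> l}) * K"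
    using sum_norm_le[of "{k. ev k \<le> l}" a "\<lambda>_. K"] assms by simp
  moreover have "0 \<le> K" using assms[of 0] norm_ge_zero order_trans by blast
  ultimately show ?thesis
    by (auto simp: cutoff_mean_def norm_divide divide_le_eq mult.commute)
qed

text \<open>The terms of the convergent series tend to \<open>0\<close>, so the eigenvalues cannot accumulate.\<close>

lemma ev_at_top:
  fixes ev :: "nat \<Rightarrow> real"
  assumes "summable (\<lambda>n. exp (- t * ev n))" "t > 0"
  shows "filterlim ev at_top sequentially"
proof -
  have "filterlim (\<lambda>n. exp (- t * ev n)) (at_right 0) sequentially"
    using summable_LIMSEQ_zero[OF assms(1)] by (simp add: filterlim_at)
  then have "filterlim (\<lambda>n. ln (exp (- t * ev n))) at_bot sequentially"
    by (rule filterlim_compose[OF ln_at_0])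
  then have "filterlim (\<lambda>n. - (- t * ev n)) at_top sequentially"
    by (simp add: filterlim_uminus_at_bot)
  then have "filterlim (\<lambda>n. t * ev n) at_top sequentially" by simp
  from filterlim_tendsto_pos_mult_at_top[OF tendsto_const _ this, of "1 / t"]
  show ?thesis using assms(2) by simp
qed

text \<open>The numerator converges to its value at \<open>\<beta>\<close>, while the partition function diverges.\<close>

lemma Abel_weight_tendsto_0:
  fixes ev :: "nat \<Rightarrow> real"
  assumes "filterlim (\<lambda>t. \<Sum>n. exp (- t * ev n)) at_top (at_right \<beta>)"
  shows "((\<lambda>t. Abel_weight ev t n) \<longlongrightarrow> 0) (at_right \<beta>)"
proof -
  have "((\<lambda>t. real (Suc n) * (exp (- t * ev n) - exp (- t * ev (Suc n))))
      \<longlongrightarrow> real (Suc n) * (exp (- \<beta> * ev n) - exp (- \<beta> * ev (Suc n)))) (at_right \<beta>)"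
    by (intro tendsto_intros)
  then show ?thesis
    unfolding Abel_weight_def
    by (rule tendsto_divide_0[OF _ filterlim_at_top_imp_at_infinity[OF assms]])
qed

context
  fixes ev :: "nat \<Rightarrow> real"
  assumes mono: "mono ev"
begin

lemma antimono_exp: "0 \<le> t \<Longrightarrow> antimono (\<lambda>n. exp (- t * ev n))"
  using mono by (auto simp: antimono_def mono_def mult_left_mono)

text \<open>Summation by parts produces the sums \<open>a\<^sub>0 + \<dots> + a\<^sub>n\<close>. They agree with the sums over
  \<open>{k. ev k \<le> ev n}\<close> whenever \<open>ev n < ev (n + 1)\<close>, and otherwise the weight is zero.\<close>

lemma Abel_weight_average:
  fixes a :: "nat \<Rightarrow> complex"
  assumes t: "0 \<le> t" and sum: "summable (\<lambda>n. exp (- t * ev n))" and a: "\<And>n. cmod (a n) \<le> K"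
    and s: "(\<lambda>n. complex_of_real (exp (- t * ev n)) * a n) sums s"
  shows "(\<lambda>n. complex_of_real (Abel_weight ev t n) * cutoff_mean ev a (ev n))
           sums (s / complex_of_real (\<Sum>n. exp (- t * ev n)))"
proof -
  let ?g = "\<lambda>n. exp (- t * ev n)"
  have eq: "complex_of_real (?g n - ?g (Suc n)) * (\<Sum>k\<le>n. a k)
      = complex_of_real (real (Suc n) * (?g n - ?g (Suc n))) * cutoff_mean ev a (ev n)" (is "?l n = ?r n") for n
  proof (cases "ev n = ev (Suc n)")
    case False
    have "{k. ev k \<le> ev n} = {..n}"
    proof (intro equalityI subsetI)
      fix k assume "k \<in> {k. ev k \<le> ev n}"
      moreover have "ev n < ev (Suc n)" using False monoD[OF mono, of n "Suc n"] by simp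
      ultimately have "\<not> Suc n \<le> k" using monoD[OF mono, of "Suc n" k] by auto
      then show "k \<in> {..n}" by simp
    qed (use monoD[OF mono] in auto)
    then show ?thesis
      unfolding cutoff_mean_def by (simp add: field_simps del: of_nat_Suc of_real_of_nat_eq)
        (simp add: algebra_simps)
  qed simp
  have "?l sums s"
    using Abel_summation_sums[OF antimono_exp[OF t] _ sum a s] by simp
  then have "?r sums s" by (simp only: eq)
  from sums_divide[OF this, of "complex_of_real (\<Sum>n. ?g n)"] show ?thesis
    unfolding Abel_weight_def by simp
qed

lemma Abel_weight_nonneg:
  assumes "0 \<le> t" "summable (\<lambda>n. exp (- t * ev n))"
  shows "0 \<le> Abel_weight ev t n"
  using antimonoD[OF antimono_exp[OF assms(1)], of n "Suc n"] suminf_nonneg[OF assms(2)]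
  unfolding Abel_weight_def by (intro divide_nonneg_nonneg mult_nonneg_nonneg) auto

text \<open>Summation by parts for \<open>a\<^sub>k = 1\<close> recovers the partition function.\<close>

lemma Abel_weight_sums_1:
  assumes t: "0 \<le> t" and sum: "summable (\<lambda>n. exp (- t * ev n))"
  shows "Abel_weight ev t sums 1"
proof -
  let ?g = "\<lambda>n. exp (- t * ev n)"
  have pos: "0 < (\<Sum>n. ?g n)" by (rule suminf_pos[OF sum]) simp
  have "(\<lambda>n. complex_of_real (?g n) * 1) sums complex_of_real (\<Sum>n. ?g n)"
    using sums_of_real[OF summable_sums[OF sum]] by simp
  from Abel_summation_sums[OF antimono_exp[OF t] _ sum _ this, of 1]
  have "(\<lambda>n. complex_of_real ((?g n - ?g (Suc n)) * real (Suc n))) sums complex_of_real (\<Sum>n. ?g n)"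
    by simp
  then have "(\<lambda>n. (?g n - ?g (Suc n)) * real (Suc n)) sums (\<Sum>n. ?g n)"
    unfolding sums_of_real_iff .
  from sums_divide[OF this, of "\<Sum>n. ?g n"] show ?thesis
    using pos by (simp add: Abel_weight_def[abs_def] mult.commute)
qed

end

text \<open>The maximum replaces the term for \<open>m = 0\<close>, where \<open>1 / 0 = 0\<close> would give \<open>\<beta>\<close> itself.\<close>

lemma inverse_index_to_at_right:
  "filterlim (\<lambda>m. \<beta> + 1 / real (max 1 m)) (at_right \<beta>) sequentially"
proof -
  have "(\<lambda>m. \<beta> + 1 / real m) \<longlonglongrightarrow> \<beta> + 0"
    by (intro tendsto_add tendsto_const lim_1_over_n)
  moreover have "\<forall>\<^sub>F m in sequentially. \<beta> + 1 / real m = \<beta> + 1 / real (max 1 m)"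
    using eventually_ge_at_top[of 1] by eventually_elim (simp add: max_absorb2)
  ultimately have "(\<lambda>m. \<beta> + 1 / real (max 1 m)) \<longlonglongrightarrow> \<beta>"
    using Lim_transform_eventually by fastforce
  then show ?thesis by (auto simp: filterlim_at intro!: always_eventually)
qed

lemma finite_if_summable_bounded_below:
  fixes f :: "'a \<Rightarrow> real"
  assumes f: "f summable_on A" "\<And>x. x \<in> A \<Longrightarrow> 0 \<le> f x" and c: "0 < c"
  shows "finite {x\<in>A. c \<le> f x}"
proof (rule ccontr)
  assume inf: "infinite {x\<in>A. c \<le> f x}"
  obtain N where N: "infsum f A / c < real N" using reals_Archimedean2 by blast
  obtain F where F: "F \<subseteq> {x\<in>A. c \<le> f x}" "finite F" "card F = N"
    using infinite_arbitrarily_large[OF inf] by metis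
  have "real N * c = (\<Sum>x\<in>F. c)" by (simp add: F(3))
  also have "\<dots> \<le> sum f F" by (rule sum_mono) (use F(1) in auto)
  also have "\<dots> \<le> infsum f A" by (rule finite_sum_le_infsum[OF f(1) F(2)]) (use F(1) f(2) in auto)
  finally show False using N c by (simp add: divide_less_eq)
qed

text \<open>A list of eigenvalues with multiplicities can be matched with an eigenbasis, eigenvalue by
  eigenvalue.\<close>

lemma bij_betw_equinumerous_fibres:
  fixes ev :: "nat \<Rightarrow> 'c" and h :: "'b \<Rightarrow> 'c"
  assumes "\<And>l. finite {n. ev n = l}" "\<And>l. finite {b\<in>B. h b = l}"
    and "\<And>l. card {n. ev n = l} = card {b\<in>B. h b = l}"
  obtains \<sigma> where "bij_betw \<sigma> UNIV B" "\<And>n. h (\<sigma> n) = ev n"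
proof -
  have "\<exists>f. bij_betw f {n. ev n = l} {b\<in>B. h b = l}" for l
    using finite_same_card_bij[OF assms] .
  then obtain f where f: "\<And>l. bij_betw (f l) {n. ev n = l} {b\<in>B. h b = l}" by metis
  define \<sigma> where "\<sigma> n = f (ev n) n" for n
  have \<sigma>: "\<sigma> n \<in> B" "h (\<sigma> n) = ev n" for n
    using bij_betwE[OF f[of "ev n"]] by (auto simp: \<sigma>_def)
  have "inj \<sigma>"
  proof (rule injI)
    fix m n assume eq: "\<sigma> m = \<sigma> n"
    then have "ev m = ev n" using \<sigma>(2) by metis
    then show "m = n"
      using eq bij_betw_imp_inj_on[OF f[of "ev n"]] by (auto simp: \<sigma>_def inj_on_def)
  qed
  moreover have "B \<subseteq> range \<sigma>"
  proof
    fix b assume "b \<in> B"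
    then have "b \<in> f (h b) ` {n. ev n = h b}"
      using bij_betw_imp_surj_on[OF f[of "h b"]] by auto
    then obtain n where "b = f (h b) n" "ev n = h b" by blast
    then have "b = \<sigma> n" by (simp add: \<sigma>_def)
    then show "b \<in> range \<sigma>" by blast
  qed
  ultimately show ?thesis using \<sigma> that unfolding bij_betw_def by blast
qed

text \<open>The eigenspace consists of the vectors whose other coordinates vanish, so the basis vectors with
  eigenvalue \<open>l\<close> are a basis of it.\<close>

lemma cdim_eigenspace_diag_op:
  fixes B :: "'a::chilbert_space set"
  assumes B: "orthonormal_basis B" and fin: "finite {b\<in>B. h b = l}"
  shows "cdim (eigenspace (diag_op B h) (complex_of_real l)) = card {b\<in>B. h b = l}"
proof -
  let ?E = "{b\<in>B. h b = l}"
  note on = orthonormal_basis_orthonormal[OF B]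
  have "x \<in> eigenspace (diag_op B h) (complex_of_real l)
      \<longleftrightarrow> diag_op B h x = Some (complex_of_real l *\<^sub>C x)" for x
    by (auto simp: eigenspace_def)
  also have "\<dots> x \<longleftrightarrow> (\<forall>b\<in>B - ?E. cinner b x = 0)" for x
    by (auto simp: diag_op_eq_Some_iff[OF B] cinner_scaleC_right)
  finally have eig: "x \<in> eigenspace (diag_op B h) (complex_of_real l) \<longleftrightarrow> (\<forall>b\<in>B - ?E. cinner b x = 0)" for x .
  have "eigenspace (diag_op B h) (complex_of_real l) = cspan ?E"
  proof (intro equalityI subsetI)
    fix x assume x: "x \<in> eigenspace (diag_op B h) (complex_of_real l)"
    have "((\<lambda>b. cinner b x *\<^sub>C b) has_sum (\<Sum>b\<in>?E. cinner b x *\<^sub>C b)) B"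
      by (rule has_sum_finite_neutralI[OF fin]) (use x[unfolded eig] in \<open>auto simp: scaleC.zero_left\<close>)
    then have "x = (\<Sum>b\<in>?E. cinner b x *\<^sub>C b)"
      using orthonormal_basis_expansion[OF B] has_sum_unique by blast
    also have "\<dots> \<in> cspan ?E"
      by (intro complex_vector.span_sum complex_vector.span_scale complex_vector.span_base)
    finally show "x \<in> cspan ?E" .
  next
    fix x assume "x \<in> cspan ?E"
    moreover have "cspan ?E \<subseteq> {x. \<forall>b\<in>B - ?E. cinner b x = 0}"
      by (rule complex_vector.span_minimal)
        (use on in \<open>auto simp: complex_vector.subspace_def orthonormal_def cinner.add_right
          cinner_scaleC_right cinner.zero_right split: if_splits\<close>)
    ultimately show "x \<in> eigenspace (diag_op B h) (complex_of_real l)" unfolding eig by blast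
  qed
  moreover have "complex_vector.independent ?E"
    unfolding complex_vector.dependent_finite[OF fin]
  proof
    assume "\<exists>u. (\<exists>v\<in>?E. u v \<noteq> 0) \<and> (\<Sum>v\<in>?E. u v *\<^sub>C v) = 0"
    then obtain u b where u: "b \<in> ?E" "u b \<noteq> 0" "(\<Sum>v\<in>?E. u v *\<^sub>C v) = 0" by blast
    then have "cinner b (\<Sum>v\<in>?E. u v *\<^sub>C v) = u b"
      by (subst orthonormal_cinner_sum[OF on fin]) auto
    then show False using u(2) unfolding u(3) by (simp add: cinner.zero_right)
  qed
  ultimately show ?thesis using complex_vector.dim_span_eq_card_independent by simp
qed

section \<open>Cut-off means and heat-kernel means\<close>

theorem proposition4p1:
  fixes D :: "'a::chilbert_space \<rightharpoonup> 'a" and ev :: "nat \<Rightarrow> real" and \<beta> :: real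
  assumes "separable_space (euclidean :: 'a topology)"
    and "self_adjoint D"
    and "compact_resolvent D"
    and "eigenvalue_sequence (op_abs D) ev"
    and "\<beta> \<ge> 0"
    and "\<forall>t>\<beta>. pos_trace (exp_abs D t) < \<infinity>"
    and "((\<lambda>t. pos_trace (exp_abs D t)) \<longlongrightarrow> \<infinity>) (at_right \<beta>)"
  shows "(\<forall>\<omega>. extended_limit \<omega> \<longrightarrow>
      (\<exists>\<omega>'. extended_limit \<omega>' \<and>
        (\<forall>a. bounded_clinear a \<longrightarrow>
          \<omega> (\<lambda>n. op_trace (a \<circ> exp_abs D (\<beta> + 1 / real n)) / op_trace (exp_abs D (\<beta> + 1 / real n)))
          = \<omega>' (\<lambda>n. op_trace (spectral_proj D (ev n) \<circ> a \<circ> spectral_proj D (ev n)) /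
                    op_trace (spectral_proj D (ev n))))))
    \<and> (\<forall>a. bounded_clinear a \<longrightarrow>
        (\<forall>L. ((\<lambda>l. op_trace (spectral_proj D l \<circ> a \<circ> spectral_proj D l) /
                   op_trace (spectral_proj D l)) \<longlongrightarrow> L) at_top \<longrightarrow>
             ((\<lambda>t. op_trace (a \<circ> exp_abs D t) / op_trace (exp_abs D t)) \<longlongrightarrow> L) (at_right \<beta>)))"
proof -
  obtain B and \<mu> :: "'a \<Rightarrow> real" where B: "orthonormal_basis B"
    and eig: "\<And>b. b \<in> B \<Longrightarrow> D b = Some (complex_of_real (\<mu> b) *\<^sub>C b)"
    using eigenbasis_exists[OF assms(2,3)] by blast
  have D: "D = diag_op B \<mu>" by (rule self_adjoint_eq_diag_op[OF B assms(2) eig])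
  have absD: "op_abs D = diag_op B (\<lambda>b. \<bar>\<mu> b\<bar>)"
    unfolding op_abs_def D by (rule fun_calc_diag_op[OF B]) simp
  have expD: "exp_abs D t = (\<lambda>x. the (diag_op B (\<lambda>b. exp (- t * \<bar>\<mu> b\<bar>)) x))" for t
    unfolding exp_abs_def absD by (subst fun_calc_diag_op[OF B]) simp_all
  have projD: "spectral_proj D l = (\<lambda>x. the (diag_op B (\<lambda>b. indicator {- l..l} (\<mu> b)) x))" for l
    unfolding spectral_proj_def D by (subst fun_calc_diag_op[OF B]) simp_all
  let ?g = "\<lambda>t b. exp (- t * \<bar>\<mu> b\<bar>)"
  have g: "0 \<le> ?g t b \<and> ?g t b \<le> 1" if "\<beta> < t" for t b
    using that assms(5) by (simp add: mult_nonneg_nonneg)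
  have g_sum: "?g t summable_on B" and pos_trace: "pos_trace (exp_abs D t) = ennreal (infsum (?g t) B)"
    if "\<beta> < t" for t
    using pos_trace_diag_op[OF B g[OF that]] assms(6) that unfolding expD by auto
  \<comment> \<open>These vectors contribute at least \<open>e\<^bsup>-(\<beta>+1)l\<^esup>\<close> each to a finite trace.\<close>
  have fin_le: "finite {b\<in>B. \<bar>\<mu> b\<bar> \<le> l}" for l
  proof -
    have "\<beta> < \<beta> + 1" by simp
    note fin = finite_if_summable_bounded_below[OF g_sum[OF this], of "exp (- (\<beta> + 1) * l)"]
    show ?thesis by (rule finite_subset[OF _ fin]) (use assms(5) in \<open>auto intro: mult_left_mono\<close>)
  qed
  have fin_eq: "finite {b\<in>B. \<bar>\<mu> b\<bar> = l}" for l
    by (rule finite_subset[OF _ fin_le[of l]]) auto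
  have mono: "mono ev" and ev: "finite {n. ev n = l}" "card {n. ev n = l} = card {b\<in>B. \<bar>\<mu> b\<bar> = l}" for l
    using assms(4) cdim_eigenspace_diag_op[OF B fin_eq] unfolding eigenvalue_sequence_def absD by auto
  obtain \<sigma> where \<sigma>: "bij_betw \<sigma> UNIV B" "\<And>n. \<bar>\<mu> (\<sigma> n)\<bar> = ev n"
    using bij_betw_equinumerous_fibres[OF ev(1) fin_eq ev(2)] by blast
  have \<sigma>B: "\<sigma> n \<in> B" for n using bij_betwE[OF \<sigma>(1)] by simp
  \<comment> \<open>The diagonal matrix elements of \<open>a\<close> in the enumerated eigenbasis.\<close>
  define a\<sigma> where "a\<sigma> a n = cinner (\<sigma> n) (a (\<sigma> n))" for a n
  have sums_if_has_sum: "(\<lambda>n. f (\<sigma> n)) sums s" if "(f has_sum s) B" for f :: "'a \<Rightarrow> complex" and s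
    using has_sum_reindex_bij_betw[OF \<sigma>(1), of f s] that by (intro has_sum_imp_sums) simp
  have a\<sigma>_id: "a\<sigma> (\<lambda>x. x) = (\<lambda>_. 1)"
    using orthonormal_basis_orthonormal[OF B] \<sigma>B by (auto simp: a\<sigma>_def orthonormal_def)
  have a\<sigma>_bound: "\<exists>K. \<forall>n. cmod (a\<sigma> a n) \<le> K" if a: "bounded_clinear a" for a
  proof -
    obtain K where K: "\<And>x. norm (a x) \<le> norm x * K"
      using a bounded_linear.bounded unfolding bounded_clinear_iff by blast
    have "cmod (a\<sigma> a n) \<le> K" for n
      using cinner_Cauchy_Schwarz[of "\<sigma> n" "a (\<sigma> n)"] K[of "\<sigma> n"]
        orthonormal_norm[OF orthonormal_basis_orthonormal[OF B] \<sigma>B[of n]] by (simp add: a\<sigma>_def)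
    then show ?thesis by blast
  qed
  have trace_exp: "(\<lambda>n. complex_of_real (exp (- t * ev n)) * a\<sigma> a n) sums op_trace (a \<circ> exp_abs D t)"
    if "\<beta> < t" "bounded_clinear a" for t a
    using sums_if_has_sum[OF op_trace_comp_diag_op[OF B g[OF that(1)] that(2) g_sum[OF that(1)]]]
    by (simp add: expD a\<sigma>_def \<sigma>(2))
  define Z where "Z t = (\<Sum>n. exp (- t * ev n))" for t
  have Z: "summable (\<lambda>n. exp (- t * ev n))" "op_trace (exp_abs D t) = complex_of_real (Z t)"
    "pos_trace (exp_abs D t) = ennreal (Z t)" if t: "\<beta> < t" for t
  proof -
    have "(?g t has_sum infsum (?g t) B) B" by (rule has_sum_infsum[OF g_sum[OF t]])
    then have "(\<lambda>n. ?g t (\<sigma> n)) sums infsum (?g t) B"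
      using has_sum_reindex_bij_betw[OF \<sigma>(1), of "?g t"] by (intro has_sum_imp_sums) simp
    then have s: "(\<lambda>n. exp (- t * ev n)) sums infsum (?g t) B" by (simp add: \<sigma>(2))
    then show sum: "summable (\<lambda>n. exp (- t * ev n))" by (rule sums_summable)
    show "pos_trace (exp_abs D t) = ennreal (Z t)"
      using sums_unique[OF s] by (simp add: pos_trace[OF t] Z_def)
    have "(\<lambda>n. complex_of_real (exp (- t * ev n))) sums op_trace (exp_abs D t)"
      using trace_exp[OF t bounded_clinear_ident] by (simp add: a\<sigma>_id comp_def)
    moreover have "(\<lambda>n. complex_of_real (exp (- t * ev n))) sums complex_of_real (Z t)"
      unfolding Z_def by (rule sums_of_real[OF summable_sums[OF sum]])
    ultimately show "op_trace (exp_abs D t) = complex_of_real (Z t)" by (rule sums_unique2)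
  qed
  have Z_top: "filterlim (\<lambda>t. \<Sum>n. exp (- t * ev n)) at_top (at_right \<beta>)"
  proof -
    have "\<forall>\<^sub>F t in at_right \<beta>. pos_trace (exp_abs D t) = ennreal (Z t)"
      using Z(3) by (auto intro: eventually_at_right_less[THEN eventually_mono])
    then have "((\<lambda>t. ennreal (Z t)) \<longlongrightarrow> top) (at_right \<beta>)"
      using Lim_transform_eventually[OF assms(7)] by simp
    then show ?thesis unfolding ennreal_tendsto_top_eq_at_top Z_def .
  qed
  have ev_top: "filterlim ev at_top sequentially"
    by (rule ev_at_top[OF Z(1), of "\<beta> + 1"]) (use assms(5) in auto)
  have P: "bounded_clinear (spectral_proj D l)" for l
    unfolding projD by (rule diag_op_bounded(2)[OF B, of _ 1]) simp
  have Pg: "0 \<le> (indicator {- l..l} (\<mu> b) :: real) \<and> (indicator {- l..l} (\<mu> b) :: real) \<le> 1" for l b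
    by (simp add: indicator_def)
  have P_supp: "(indicator {- l..l} (\<mu> b) :: real) = (if \<bar>\<mu> b\<bar> \<le> l then 1 else 0)" for l b
    by (auto simp: indicator_def)
  have P_sum: "(\<lambda>b. indicator {- l..l} (\<mu> b) :: real) summable_on B" for l
  proof -
    have "((\<lambda>b. indicator {- l..l} (\<mu> b)) has_sum (\<Sum>b | b \<in> B \<and> \<bar>\<mu> b\<bar> \<le> l. indicator {- l..l} (\<mu> b) :: real)) B"
      by (rule has_sum_finite_neutralI[OF fin_le]) (auto simp: P_supp)
    then show ?thesis by (rule has_sum_imp_summable)
  qed
  have ev_le: "\<sigma> ` {n. ev n \<le> l} = {b\<in>B. \<bar>\<mu> b\<bar> \<le> l}" for l
    using bij_betw_imp_surj_on[OF \<sigma>(1)] by (auto simp: \<sigma>(2)[symmetric])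
  have \<sigma>_inj: "inj_on \<sigma> A" for A
    using bij_betw_imp_inj_on[OF \<sigma>(1)] inj_on_subset by blast
  have trace_proj: "op_trace (a \<circ> spectral_proj D l) = (\<Sum>n | ev n \<le> l. a\<sigma> a n)"
    if a: "bounded_clinear a" for a l
  proof -
    have "((\<lambda>b. complex_of_real (indicator {- l..l} (\<mu> b)) * cinner b (a b)) has_sum op_trace (a \<circ> spectral_proj D l)) B"
      using op_trace_comp_diag_op[OF B Pg a P_sum] unfolding projD .
    moreover have "((\<lambda>b. complex_of_real (indicator {- l..l} (\<mu> b)) * cinner b (a b)) has_sum
        (\<Sum>b | b \<in> B \<and> \<bar>\<mu> b\<bar> \<le> l. cinner b (a b))) B"
      by (rule has_sum_finite_neutralI[OF fin_le]) (auto simp: P_supp)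
    ultimately have "op_trace (a \<circ> spectral_proj D l) = (\<Sum>b | b \<in> B \<and> \<bar>\<mu> b\<bar> \<le> l. cinner b (a b))"
      by (rule has_sum_unique)
    also have "\<dots> = (\<Sum>n | ev n \<le> l. a\<sigma> a n)"
      unfolding ev_le[symmetric] a\<sigma>_def by (rule sum.reindex_cong[OF \<sigma>_inj refl]) simp
    finally show ?thesis .
  qed
  have mean: "op_trace (spectral_proj D l \<circ> a \<circ> spectral_proj D l) / op_trace (spectral_proj D l)
      = cutoff_mean ev (a\<sigma> a) l" if a: "bounded_clinear a" for a l
  proof -
    have "a\<sigma> (spectral_proj D l \<circ> a) n = a\<sigma> a n" if "ev n \<le> l" for n
      using cinner_diag_op[OF B _ \<sigma>B, of "a (\<sigma> n)" "\<lambda>b. indicator {- l..l} (\<mu> b)" n] that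
        diag_op_bounded(1)[OF B, of "\<lambda>b. indicator {- l..l} (\<mu> b)" 1]
      by (simp add: a\<sigma>_def projD P_supp \<sigma>(2))
    then have "op_trace (spectral_proj D l \<circ> a \<circ> spectral_proj D l) = (\<Sum>n | ev n \<le> l. a\<sigma> a n)"
      using trace_proj[OF bounded_clinear_comp[OF P a]] by simp
    moreover have "op_trace (spectral_proj D l) = of_nat (card {n. ev n \<le> l})"
      using trace_proj[OF bounded_clinear_ident] by (simp add: a\<sigma>_id comp_def)
    ultimately show ?thesis by (simp add: cutoff_mean_def)
  qed
  have ratio: "op_trace (a \<circ> exp_abs D t) / op_trace (exp_abs D t)
      = (\<Sum>n. complex_of_real (Abel_weight ev t n) * cutoff_mean ev (a\<sigma> a) (ev n))"
    if t: "\<beta> < t" and a: "bounded_clinear a" for t a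
  proof -
    obtain K where K: "\<And>n. cmod (a\<sigma> a n) \<le> K" using a\<sigma>_bound[OF a] by blast
    have "0 \<le> t" using t assms(5) by simp
    from sums_unique[OF Abel_weight_average[OF mono this Z(1)[OF t] K trace_exp[OF t a]]]
    show ?thesis by (simp add: Z(2)[OF t] Z_def)
  qed
  have weight: "0 \<le> Abel_weight ev t n" "Abel_weight ev t sums 1" if "\<beta> < t" for t n
    using Abel_weight_nonneg[OF mono _ Z(1)[OF that]] Abel_weight_sums_1[OF mono _ Z(1)[OF that]]
      that assms(5) by auto
  note weight_0 = Abel_weight_tendsto_0[OF Z_top]
  show ?thesis
  proof (intro conjI allI impI)
    fix \<omega> :: "(nat \<Rightarrow> complex) \<Rightarrow> complex" assume \<omega>: "extended_limit \<omega>"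
    \<comment> \<open>The row for \<open>m = 0\<close> is a copy of the row for \<open>m = 1\<close>, because no weights exist at \<open>t = \<beta>\<close>; an
      extended limit does not see the difference.\<close>
    define p where "p m = Abel_weight ev (\<beta> + 1 / real (max 1 m))" for m
    define \<omega>' where "\<omega>' x = \<omega> (\<lambda>m. \<Sum>n. complex_of_real (p m n) * x n)" for x
    have p: "0 \<le> p m n" "p m sums 1" for m n
      using weight[of "\<beta> + 1 / real (max 1 m)"] by (auto simp: p_def)
    have "(\<lambda>m. p m n) \<longlonglongrightarrow> 0" for n
      unfolding p_def by (rule filterlim_compose[OF weight_0 inverse_index_to_at_right])
    then have "extended_limit \<omega>'"
      unfolding \<omega>'_def by (rule extended_limit_Toeplitz[OF \<omega> p])
    moreover have "\<omega> (\<lambda>n. op_trace (a \<circ> exp_abs D (\<beta> + 1 / real n)) / op_trace (exp_abs D (\<beta> + 1 / real n)))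
        = \<omega>' (\<lambda>n. op_trace (spectral_proj D (ev n) \<circ> a \<circ> spectral_proj D (ev n)) / op_trace (spectral_proj D (ev n)))"
      if a: "bounded_clinear a" for a
      unfolding \<omega>'_def mean[OF a]
    proof (rule extended_limit_cong[OF \<omega>, symmetric])
      obtain K where "\<And>n. cmod (a\<sigma> a n) \<le> K" using a\<sigma>_bound[OF a] by blast
      then have "cmod (\<Sum>n. complex_of_real (p m n) * cutoff_mean ev (a\<sigma> a) (ev n)) \<le> 1 * K" for m
        by (intro bounded_average(2)[OF p] cmod_cutoff_mean_le)
      then show "Bseq (\<lambda>m. \<Sum>n. complex_of_real (p m n) * cutoff_mean ev (a\<sigma> a) (ev n))"
        by (rule BseqI')
      show "\<forall>\<^sub>F m in sequentially. (\<Sum>n. complex_of_real (p m n) * cutoff_mean ev (a\<sigma> a) (ev n))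
          = op_trace (a \<circ> exp_abs D (\<beta> + 1 / real m)) / op_trace (exp_abs D (\<beta> + 1 / real m))"
        using eventually_ge_at_top[of 1]
        by eventually_elim (subst ratio[OF _ a], simp_all add: p_def max_absorb2)
    qed
    ultimately show "\<exists>\<omega>'. extended_limit \<omega>' \<and> (\<forall>a. bounded_clinear a \<longrightarrow>
        \<omega> (\<lambda>n. op_trace (a \<circ> exp_abs D (\<beta> + 1 / real n)) / op_trace (exp_abs D (\<beta> + 1 / real n)))
        = \<omega>' (\<lambda>n. op_trace (spectral_proj D (ev n) \<circ> a \<circ> spectral_proj D (ev n)) / op_trace (spectral_proj D (ev n))))"
      by blast
  next
    fix a :: "'a \<Rightarrow> 'a" and L assume a: "bounded_clinear a"
      and lim: "((\<lambda>l. op_trace (spectral_proj D l \<circ> a \<circ> spectral_proj D l) / op_trace (spectral_proj D l)) \<longlongrightarrow> L) at_top"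
    have "(\<lambda>n. cutoff_mean ev (a\<sigma> a) (ev n)) \<longlonglongrightarrow> L"
      by (rule filterlim_compose[OF lim[unfolded mean[OF a]] ev_top])
    then have "((\<lambda>t. \<Sum>n. complex_of_real (Abel_weight ev t n) * cutoff_mean ev (a\<sigma> a) (ev n)) \<longlongrightarrow> L) (at_right \<beta>)"
      by (intro Toeplitz_regular weight_0)
        (use weight in \<open>auto intro: eventually_at_right_less[THEN eventually_mono]\<close>)
    then show "((\<lambda>t. op_trace (a \<circ> exp_abs D t) / op_trace (exp_abs D t)) \<longlongrightarrow> L) (at_right \<beta>)"
      by (rule Lim_transform_eventually)
        (use ratio[OF _ a] in \<open>auto intro: eventually_at_right_less[THEN eventually_mono]\<close>)
  qed
qed

end
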